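(* Let $R$ be an associative ring with unit, let $M$ be a left $R$-module which is $M^{(\Lambda)}$-projective for every index set $\Lambda$, and let $N<M$ be a (proper) fully invariant nil-submodule of $M$ such that $\mathbf{l}_N(N^j)=0$ for all $j>0$. If $M$ satisfies the ascending chain condition on annihilators, then there exist submodules $A_1,\dots,A_k,\dots\subseteq N$ (a sequence indexed by the positive integers) such that: (1) ${A_1}_M\cdots{}_MA_k\neq 0$ for all $k>0$; and (2) ${A_1}_M\cdots{}_M{A_k}_MA_n=0$ if $n\leq k$.
   Context: Modules are unitary left modules; $S=\operatorname{End}_R(M)$, with endomorphisms acting on the left. The notation $N<M$ means that $N$ is a proper submodule of $M$. $M^{(\Lambda)}$ is the direct sum of copies of $M$ indexed by $\Lambda$. A module $M$ is $L$-projective if for every epimorphism $\rho:L\to L'$ and every homomorphism $\alpha:M\to L'$ there is $\overline{\alpha}:M\to L$ with $\rho\overline{\alpha}=\alpha$. A submodule $N\leq M$ is fully invariant if $f(N)\subseteq N$ for all $f\in S$. $M$ satisfies the ascending chain condition (acc) on annihilators if every ascending chain $\bigcap_{f\in Y_1}\operatorname{Ker} f\subseteq\bigcap_{f\in Y_2}\operatorname{Ker} f\subseteq\cdots$ with $Y_i\subseteq S$ becomes stationary in finitely many steps. A submodule $N$ of $M$ is a nil-submodule if for every $n\in N$ every homomorphism $f:M\to Rn$, regarded as an element of $S$, is nilpotent. For submodules $A,B\leq M$ the product is $A_MB=\sum\{f(A)\mid f\in\operatorname{Hom}_R(M,B)\}$; it is known to be associative on the lattice of submodules of $M$ when $M$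 is $M^{(\Lambda)}$-projective for every $\Lambda$, so iterated products are written without brackets. Powers: $N^1=N$, $N^{\ell+1}=(N^\ell)_MN$. For $K\leq M$, $\operatorname{Ann}_M(K)=\bigcap\{\operatorname{Ker} f\mid f\in\operatorname{Hom}_R(M,K)\}$, and for $K\leq N\leq M$, $\mathbf{l}_N(K)=\operatorname{Ann}_M(K)\cap N$.
   Formalization: The submodule N is additionally assumed to be nonzero; for N = 0 (e.g. R = M a field) all the hypotheses hold but (1) fails, since it would require a nonzero submodule of 0. *)

theory Defs
  imports "HOL-Algebra.Module" "HOL-Library.Countable_Set"
begin

text \<open>
  The locale \<open>module\<close> of the library requires a commutative ring of scalars, so unitary left
  modules over an arbitrary unital ring are introduced here, on the same records.  The library's
  locale \<open>submodule\<close> makes no commutativity assumption and is used as it is.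
\<close>

locale left_module = R?: ring R + M?: abelian_group M
  for R :: "('r, 'x) ring_scheme" (structure) and M :: "('r, 'm, 'y) module_scheme" (structure) +
  assumes smult_closed [simp, intro]:
      "\<lbrakk>a \<in> carrier R; x \<in> carrier M\<rbrakk> \<Longrightarrow> a \<odot>\<^bsub>M\<^esub> x \<in> carrier M"
    and smult_l_distr:
      "\<lbrakk>a \<in> carrier R; b \<in> carrier R; x \<in> carrier M\<rbrakk> \<Longrightarrow>
        (a \<oplus>\<^bsub>R\<^esub> b) \<odot>\<^bsub>M\<^esub> x = a \<odot>\<^bsub>M\<^esub> x \<oplus>\<^bsub>M\<^esub> b \<odot>\<^bsub>M\<^esub> x"
    and smult_r_distr:
      "\<lbrakk>a \<in> carrier R; x \<in> carrier M; y \<in> carrier M\<rbrakk> \<Longrightarrow>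
        a \<odot>\<^bsub>M\<^esub> (x \<oplus>\<^bsub>M\<^esub> y) = a \<odot>\<^bsub>M\<^esub> x \<oplus>\<^bsub>M\<^esub> a \<odot>\<^bsub>M\<^esub> y"
    and smult_assoc1:
      "\<lbrakk>a \<in> carrier R; b \<in> carrier R; x \<in> carrier M\<rbrakk> \<Longrightarrow>
        (a \<otimes>\<^bsub>R\<^esub> b) \<odot>\<^bsub>M\<^esub> x = a \<odot>\<^bsub>M\<^esub> (b \<odot>\<^bsub>M\<^esub> x)"
    and smult_one [simp]: "x \<in> carrier M \<Longrightarrow> \<one>\<^bsub>R\<^esub> \<odot>\<^bsub>M\<^esub> x = x"

text \<open>
  Homomorphisms are HOL functions, unconstrained outside \<open>carrier M\<close>; two of them represent the
  same homomorphism iff they agree on \<open>carrier M\<close>.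
\<close>

definition lmod_hom ::
    "('r, 'x) ring_scheme \<Rightarrow> ('r, 'm, 'y) module_scheme \<Rightarrow> ('r, 'n, 'z) module_scheme \<Rightarrow> ('m \<Rightarrow> 'n) set"
  where "lmod_hom R M L = {f \<in> carrier M \<rightarrow> carrier L.
    (\<forall>x\<in>carrier M. \<forall>y\<in>carrier M. f (x \<oplus>\<^bsub>M\<^esub> y) = f x \<oplus>\<^bsub>L\<^esub> f y) \<and>
    (\<forall>r\<in>carrier R. \<forall>x\<in>carrier M. f (r \<odot>\<^bsub>M\<^esub> x) = r \<odot>\<^bsub>L\<^esub> f x)}"

abbreviation lmod_End :: "('r, 'x) ring_scheme \<Rightarrow> ('r, 'm, 'y) module_scheme \<Rightarrow> ('m \<Rightarrow> 'm) set"
  where "lmod_End R M \<equiv> lmod_hom R M M"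

text \<open>Homomorphisms from \<open>M\<close> to a submodule \<open>K\<close> of \<open>M\<close>.\<close>

abbreviation hom_into ::
    "('r, 'x) ring_scheme \<Rightarrow> ('r, 'm, 'y) module_scheme \<Rightarrow> 'm set \<Rightarrow> ('m \<Rightarrow> 'm) set"
  where "hom_into R M K \<equiv> lmod_hom R M (M\<lparr>carrier := K\<rparr>)"


subsection \<open>Projectivity\<close>

text \<open>
  The codomains \<open>L'\<close> range over modules on the same HOL type as \<open>L\<close>. As every
  epimorphic image of \<open>L\<close> has an isomorphic copy there, this is no restriction: see
  \<open>rel_projectiveD\<close> below.
\<close>

definition rel_projective ::
    "('r, 'x) ring_scheme \<Rightarrow> ('r, 'm, 'y) module_scheme \<Rightarrow> ('r, 'l) module \<Rightarrow> bool"
  where "rel_projective R M L \<longleftrightarrow>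
    (\<forall>(L' :: ('r, 'l) module) \<rho> \<alpha>.
       left_module R L' \<and> \<rho> \<in> lmod_hom R L L' \<and> \<rho> ` carrier L = carrier L' \<and> \<alpha> \<in> lmod_hom R M L'
       \<longrightarrow> (\<exists>\<beta>\<in>lmod_hom R M L. \<forall>x\<in>carrier M. \<rho> (\<beta> x) = \<alpha> x))"

text \<open>
  The direct sum of copies of \<open>M\<close> indexed by \<open>\<Lambda>\<close>. The fields \<open>mult\<close> and \<open>one\<close>, present in
  module records only because these extend ring records, are irrelevant.
\<close>

definition direct_power :: "('r, 'm, 'y) module_scheme \<Rightarrow> 'i set \<Rightarrow> ('r, 'i \<Rightarrow> 'm) module"
  where "direct_power M \<Lambda> =
    \<lparr>carrier = {x \<in> \<Lambda> \<rightarrow>\<^sub>E carrier M. finite {i \<in> \<Lambda>. x i \<noteq> \<zero>\<^bsub>M\<^esub>}},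
     mult = undefined, one = undefined,
     zero = (\<lambda>i\<in>\<Lambda>. \<zero>\<^bsub>M\<^esub>),
     add = (\<lambda>x y. \<lambda>i\<in>\<Lambda>. x i \<oplus>\<^bsub>M\<^esub> y i),
     smult = (\<lambda>r x. \<lambda>i\<in>\<Lambda>. r \<odot>\<^bsub>M\<^esub> x i)\<rparr>"

text \<open>
  \<open>M\<close> is \<open>M\<^sup>(\<^sup>\<Lambda>\<^sup>)\<close>-projective for every index set \<open>\<Lambda>\<close>. HOL cannot quantify over types inside a
  definition, so \<open>\<Lambda>\<close> ranges over the subsets of one type that is large enough: by
  \<open>sigma_projectiveD\<close> below the property then holds for index sets in every type.
\<close>

definition sigma_projective :: "('r, 'x) ring_scheme \<Rightarrow> ('r, 'm, 'y) module_scheme \<Rightarrow> bool"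
  where "sigma_projective R M \<longleftrightarrow> (\<forall>\<Lambda> :: ('m \<times> nat) set. rel_projective R M (direct_power M \<Lambda>))"


subsection \<open>Submodules, products and annihilators\<close>

definition fully_invariant :: "('r, 'x) ring_scheme \<Rightarrow> ('r, 'm, 'y) module_scheme \<Rightarrow> 'm set \<Rightarrow> bool"
  where "fully_invariant R M N \<longleftrightarrow> (\<forall>f\<in>lmod_End R M. f ` N \<subseteq> N)"

definition cyclic_submodule ::
    "('r, 'x) ring_scheme \<Rightarrow> ('r, 'm, 'y) module_scheme \<Rightarrow> 'm \<Rightarrow> 'm set"
  where "cyclic_submodule R M n = (\<lambda>r. r \<odot>\<^bsub>M\<^esub> n) ` carrier R"

definition nilpotent_on :: "('r, 'm, 'y) module_scheme \<Rightarrow> ('m \<Rightarrow> 'm) \<Rightarrow> bool"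
  where "nilpotent_on M f \<longleftrightarrow> (\<exists>k. \<forall>x\<in>carrier M. (f ^^ k) x = \<zero>\<^bsub>M\<^esub>)"

definition nil_submodule :: "('r, 'x) ring_scheme \<Rightarrow> ('r, 'm, 'y) module_scheme \<Rightarrow> 'm set \<Rightarrow> bool"
  where "nil_submodule R M N \<longleftrightarrow>
    submodule N R M \<and> (\<forall>n\<in>N. \<forall>f\<in>hom_into R M (cyclic_submodule R M n). nilpotent_on M f)"

text \<open>The intersection of the kernels of the members of \<open>Y\<close>, which is \<open>M\<close> for empty \<open>Y\<close>.\<close>

definition ker_Inter :: "('r, 'm, 'y) module_scheme \<Rightarrow> ('m \<Rightarrow> 'm) set \<Rightarrow> 'm set"
  where "ker_Inter M Y = {x \<in> carrier M. \<forall>f\<in>Y. f x = \<zero>\<^bsub>M\<^esub>}"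

definition acc_annihilators :: "('r, 'x) ring_scheme \<Rightarrow> ('r, 'm, 'y) module_scheme \<Rightarrow> bool"
  where "acc_annihilators R M \<longleftrightarrow>
    (\<forall>Y :: nat \<Rightarrow> ('m \<Rightarrow> 'm) set.
       (\<forall>i. Y i \<subseteq> lmod_End R M) \<and> (\<forall>i. ker_Inter M (Y i) \<subseteq> ker_Inter M (Y (Suc i)))
       \<longrightarrow> (\<exists>n. \<forall>m\<ge>n. ker_Inter M (Y m) = ker_Inter M (Y n)))"

definition Ann :: "('r, 'x) ring_scheme \<Rightarrow> ('r, 'm, 'y) module_scheme \<Rightarrow> 'm set \<Rightarrow> 'm set"
  where "Ann R M K = ker_Inter M (hom_into R M K)"

definition l_ann :: "('r, 'x) ring_scheme \<Rightarrow> ('r, 'm, 'y) module_scheme \<Rightarrow> 'm set \<Rightarrow> 'm set \<Rightarrow> 'm set"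
  where "l_ann R M N K = Ann R M K \<inter> N"

definition submodule_Sum :: "('r, 'm, 'y) module_scheme \<Rightarrow> 'm set set \<Rightarrow> 'm set"
  where "submodule_Sum M \<F> =
    {finsum M x \<G> | x \<G>. finite \<G> \<and> \<G> \<subseteq> \<F> \<and> (\<forall>B\<in>\<G>. x B \<in> B)}"

definition mprod ::
    "('r, 'x) ring_scheme \<Rightarrow> ('r, 'm, 'y) module_scheme \<Rightarrow> 'm set \<Rightarrow> 'm set \<Rightarrow> 'm set"
  where "mprod R M A B = submodule_Sum M {f ` A | f. f \<in> hom_into R M B}"

text \<open>
  \<open>mprod_seq R M A k\<close> is the product of \<open>A 1, \<dots>, A k\<close>, bracketed to the left as in the definition of powers.
  The value at \<open>0\<close> is a dummy.
\<close>

fun mprod_seq ::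
    "('r, 'x) ring_scheme \<Rightarrow> ('r, 'm, 'y) module_scheme \<Rightarrow> (nat \<Rightarrow> 'm set) \<Rightarrow> nat \<Rightarrow> 'm set"
  where
    "mprod_seq R M A 0 = carrier M"
  | "mprod_seq R M A (Suc 0) = A 1"
  | "mprod_seq R M A (Suc (Suc k)) = mprod R M (mprod_seq R M A (Suc k)) (A (Suc (Suc k)))"

abbreviation mpower ::
    "('r, 'x) ring_scheme \<Rightarrow> ('r, 'm, 'y) module_scheme \<Rightarrow> 'm set \<Rightarrow> nat \<Rightarrow> 'm set"
  where "mpower R M N \<equiv> mprod_seq R M (\<lambda>_. N)"


subsection \<open>Independence of the HOL types used for projectivity\<close>

lemma left_module_epi_image:
  fixes L :: "('r, 'l, 'y) module_scheme" and L' :: "('r, 'k, 'z) module_scheme"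
  assumes L: "left_module R L"
    and onto: "h ` carrier L = carrier L'"
    and zero: "h \<zero>\<^bsub>L\<^esub> = \<zero>\<^bsub>L'\<^esub>"
    and add: "\<And>x y. \<lbrakk>x \<in> carrier L; y \<in> carrier L\<rbrakk> \<Longrightarrow> h x \<oplus>\<^bsub>L'\<^esub> h y = h (x \<oplus>\<^bsub>L\<^esub> y)"
    and smult: "\<And>r x. \<lbrakk>r \<in> carrier R; x \<in> carrier L\<rbrakk> \<Longrightarrow> r \<odot>\<^bsub>L'\<^esub> h x = h (r \<odot>\<^bsub>L\<^esub> x)"
  shows "left_module R L'"
proof -
  interpret L: left_module R L by fact
  have mem: "h x \<in> carrier L'" if "x \<in> carrier L" for x using that onto by auto
  have "abelian_group L'"
  proof (rule abelian_groupI)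
    show "\<zero>\<^bsub>L'\<^esub> \<in> carrier L'" using mem[of "\<zero>\<^bsub>L\<^esub>"] zero by simp
    show "x \<oplus>\<^bsub>L'\<^esub> y \<in> carrier L'" if "x \<in> carrier L'" "y \<in> carrier L'" for x y
      using that unfolding onto[symmetric] by (auto simp: add)
    show "x \<oplus>\<^bsub>L'\<^esub> y \<oplus>\<^bsub>L'\<^esub> z = x \<oplus>\<^bsub>L'\<^esub> (y \<oplus>\<^bsub>L'\<^esub> z)"
      if "x \<in> carrier L'" "y \<in> carrier L'" "z \<in> carrier L'" for x y z
      using that unfolding onto[symmetric] by (auto simp: add L.a_assoc)
    show "x \<oplus>\<^bsub>L'\<^esub> y = y \<oplus>\<^bsub>L'\<^esub> x" if "x \<in> carrier L'" "y \<in> carrier L'" for x y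
      using that unfolding onto[symmetric] by (auto simp: add L.a_comm)
    show "\<zero>\<^bsub>L'\<^esub> \<oplus>\<^bsub>L'\<^esub> x = x" if "x \<in> carrier L'" for x
      using that unfolding onto[symmetric] zero[symmetric] by (auto simp: add)
    show "\<exists>y\<in>carrier L'. y \<oplus>\<^bsub>L'\<^esub> x = \<zero>\<^bsub>L'\<^esub>" if "x \<in> carrier L'" for x
    proof -
      from that onto obtain u where u: "u \<in> carrier L" "x = h u" by auto
      show ?thesis
        using u mem[of "\<ominus>\<^bsub>L\<^esub> u"] by (intro bexI[of _ "h (\<ominus>\<^bsub>L\<^esub> u)"]) (auto simp: add L.l_neg zero)
    qed
  qed
  moreover have "left_module_axioms R L'"
    by unfold_locales
       (auto simp: onto[symmetric] add smult L.smult_l_distr L.smult_r_distr L.smult_assoc1)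
  ultimately show ?thesis
    using L.R.ring_axioms by (simp add: left_module_def)
qed

lemma lmod_homD:
  assumes "f \<in> lmod_hom R M L"
  shows "x \<in> carrier M \<Longrightarrow> f x \<in> carrier L"
    and "\<lbrakk>x \<in> carrier M; y \<in> carrier M\<rbrakk> \<Longrightarrow> f (x \<oplus>\<^bsub>M\<^esub> y) = f x \<oplus>\<^bsub>L\<^esub> f y"
    and "\<lbrakk>r \<in> carrier R; x \<in> carrier M\<rbrakk> \<Longrightarrow> f (r \<odot>\<^bsub>M\<^esub> x) = r \<odot>\<^bsub>L\<^esub> f x"
  using assms by (auto simp: lmod_hom_def)

lemma lmod_hom_zero:
  assumes "f \<in> lmod_hom R M L" "left_module R M" "left_module R L"
  shows "f \<zero>\<^bsub>M\<^esub> = \<zero>\<^bsub>L\<^esub>"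
proof -
  interpret M: left_module R M by fact
  interpret L: left_module R L by fact
  have "f \<zero>\<^bsub>M\<^esub> \<oplus>\<^bsub>L\<^esub> f \<zero>\<^bsub>M\<^esub> = f \<zero>\<^bsub>M\<^esub>"
    using lmod_homD(2)[OF assms(1) M.zero_closed M.zero_closed] by simp
  then show ?thesis
    using lmod_homD(1)[OF assms(1) M.zero_closed] by (metis L.M.add.r_cancel_one')
qed

lemma rel_projectiveD:
  fixes L :: "('r, 'l) module" and L' :: "('r, 'k, 'z) module_scheme"
  assumes proj: "rel_projective R M L"
    and L: "left_module R L" and L': "left_module R L'"
    and \<rho>: "\<rho> \<in> lmod_hom R L L'" "\<rho> ` carrier L = carrier L'"
    and \<alpha>: "\<alpha> \<in> lmod_hom R M L'"
  shows "\<exists>\<beta>\<in>lmod_hom R M L. \<forall>x\<in>carrier M. \<rho> (\<beta> x) = \<alpha> x"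
proof -
  interpret L: left_module R L by fact
  interpret L': left_module R L' by fact
  define s where "s = inv_into (carrier L) \<rho>"
  have s: "s y \<in> carrier L" "\<rho> (s y) = y" if "y \<in> carrier L'" for y
    using that \<rho>(2) by (auto simp: s_def inv_into_into f_inv_into_f)
  define C :: "('r, 'l) module" where "C =
    \<lparr>carrier = s ` carrier L', mult = undefined, one = undefined, zero = s \<zero>\<^bsub>L'\<^esub>,
     add = (\<lambda>x y. s (\<rho> x \<oplus>\<^bsub>L'\<^esub> \<rho> y)), smult = (\<lambda>r x. s (r \<odot>\<^bsub>L'\<^esub> \<rho> x))\<rparr>"
  have C: "left_module R C"
    by (rule left_module_epi_image[OF L', of s]) (auto simp: C_def s)
  have 1: "s \<circ> \<rho> \<in> lmod_hom R L C"
    using \<rho>(1) by (auto simp: lmod_hom_def C_def s Pi_iff)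
  have 2: "(s \<circ> \<rho>) ` carrier L = carrier C"
    unfolding image_comp[symmetric] \<rho>(2) by (simp add: C_def)
  have 3: "s \<circ> \<alpha> \<in> lmod_hom R M C"
    using \<alpha> by (auto simp: lmod_hom_def C_def s Pi_iff)
  from proj C 1 2 3 obtain \<beta> where \<beta>: "\<beta> \<in> lmod_hom R M L"
      and eq: "\<forall>x\<in>carrier M. (s \<circ> \<rho>) (\<beta> x) = (s \<circ> \<alpha>) x"
    unfolding rel_projective_def by blast
  have "\<rho> (\<beta> x) = \<alpha> x" if "x \<in> carrier M" for x
  proof -
    have "\<rho> (s (\<rho> (\<beta> x))) = \<rho> (s (\<alpha> x))" using eq that by simp
    then show ?thesis
      using s(2) lmod_homD(1)[OF \<alpha> that] lmod_homD(1)[OF \<rho>(1) lmod_homD(1)[OF \<beta> that]] by simp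
  qed
  with \<beta> show ?thesis by blast
qed

lemma left_module_direct_power:
  assumes "left_module R M"
  shows "left_module R (direct_power M \<Lambda>)"
proof -
  interpret M: left_module R M by fact
  have r0: "r \<odot>\<^bsub>M\<^esub> \<zero>\<^bsub>M\<^esub> = \<zero>\<^bsub>M\<^esub>" if "r \<in> carrier R" for r
    using M.smult_r_distr[OF that M.zero_closed M.zero_closed] that
    by (metis M.M.add.r_cancel_one' M.M.zero_closed M.M.r_zero M.smult_closed)
  let ?C = "carrier (direct_power M \<Lambda>)"
  have C: "x \<in> ?C \<longleftrightarrow> x \<in> \<Lambda> \<rightarrow>\<^sub>E carrier M \<and> finite {i \<in> \<Lambda>. x i \<noteq> \<zero>\<^bsub>M\<^esub>}" for x
    by (simp add: direct_power_def)
  have add: "(\<lambda>i\<in>\<Lambda>. x i \<oplus>\<^bsub>M\<^esub> y i) \<in> ?C" if "x \<in> ?C" "y \<in> ?C" for x y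
  proof -
    have "{i \<in> \<Lambda>. (\<lambda>i\<in>\<Lambda>. x i \<oplus>\<^bsub>M\<^esub> y i) i \<noteq> \<zero>\<^bsub>M\<^esub>} \<subseteq> {i \<in> \<Lambda>. x i \<noteq> \<zero>\<^bsub>M\<^esub>} \<union> {i \<in> \<Lambda>. y i \<noteq> \<zero>\<^bsub>M\<^esub>}"
      by auto
    from finite_subset[OF this] that show ?thesis unfolding C by (auto simp del: restrict_apply)
  qed
  have smult: "(\<lambda>i\<in>\<Lambda>. r \<odot>\<^bsub>M\<^esub> x i) \<in> ?C" if "r \<in> carrier R" "x \<in> ?C" for r x
  proof -
    have "{i \<in> \<Lambda>. (\<lambda>i\<in>\<Lambda>. r \<odot>\<^bsub>M\<^esub> x i) i \<noteq> \<zero>\<^bsub>M\<^esub>} \<subseteq> {i \<in> \<Lambda>. x i \<noteq> \<zero>\<^bsub>M\<^esub>}"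
      using that by (auto simp: r0)
    from finite_subset[OF this] that show ?thesis unfolding C by (auto simp del: restrict_apply)
  qed
  have neg: "(\<lambda>i\<in>\<Lambda>. \<ominus>\<^bsub>M\<^esub> x i) \<in> ?C" if "x \<in> ?C" for x
  proof -
    have "{i \<in> \<Lambda>. (\<lambda>i\<in>\<Lambda>. \<ominus>\<^bsub>M\<^esub> x i) i \<noteq> \<zero>\<^bsub>M\<^esub>} \<subseteq> {i \<in> \<Lambda>. x i \<noteq> \<zero>\<^bsub>M\<^esub>}"
      by auto
    from finite_subset[OF this] that show ?thesis unfolding C by (auto simp del: restrict_apply)
  qed
  have app: "x i \<in> carrier M" if "x \<in> ?C" "i \<in> \<Lambda>" for x i
    using that unfolding C by auto
  have ext: "x = y" if "x \<in> ?C" "y \<in> ?C" "\<And>i. i \<in> \<Lambda> \<Longrightarrow> x i = y i" for x y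
    using that unfolding C by (auto intro: PiE_ext)
  have zero: "(\<lambda>i\<in>\<Lambda>. \<zero>\<^bsub>M\<^esub>) \<in> ?C" unfolding C by auto
  have sel: "\<zero>\<^bsub>direct_power M \<Lambda>\<^esub> = (\<lambda>i\<in>\<Lambda>. \<zero>\<^bsub>M\<^esub>)"
    "x \<oplus>\<^bsub>direct_power M \<Lambda>\<^esub> y = (\<lambda>i\<in>\<Lambda>. x i \<oplus>\<^bsub>M\<^esub> y i)"
    "r \<odot>\<^bsub>direct_power M \<Lambda>\<^esub> x = (\<lambda>i\<in>\<Lambda>. r \<odot>\<^bsub>M\<^esub> x i)" for x y r
    by (simp_all add: direct_power_def)
  let ?P = "direct_power M \<Lambda>"
  note closed = add[folded sel] smult[folded sel] zero[folded sel]
  have pt: "\<zero>\<^bsub>?P\<^esub> i = \<zero>\<^bsub>M\<^esub>" "(x \<oplus>\<^bsub>?P\<^esub> y) i = x i \<oplus>\<^bsub>M\<^esub> y i"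
    "(r \<odot>\<^bsub>?P\<^esub> x) i = r \<odot>\<^bsub>M\<^esub> x i" if "i \<in> \<Lambda>" for x y r i
    using that by (simp_all add: sel)
  have "abelian_group ?P"
  proof (rule abelian_groupI)
    show "\<exists>y\<in>?C. y \<oplus>\<^bsub>?P\<^esub> x = \<zero>\<^bsub>?P\<^esub>" if "x \<in> ?C" for x
      using that by (intro bexI[OF _ neg[OF that]] ext closed neg) (auto simp: pt app M.l_neg)
    show "x \<oplus>\<^bsub>?P\<^esub> y = y \<oplus>\<^bsub>?P\<^esub> x" if "x \<in> ?C" "y \<in> ?C" for x y
      using that by (intro ext closed) (auto simp: pt app M.a_comm)
  qed (auto intro!: ext closed simp: pt app M.a_assoc)
  moreover have "left_module_axioms R ?P"
    by unfold_locales
       (auto intro!: ext closed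
          simp: pt app M.smult_l_distr M.smult_r_distr M.smult_assoc1)
  ultimately show ?thesis
    using M.R.ring_axioms by (simp add: left_module_def)
qed

lemma sigma_projectiveD:
  fixes \<Lambda> :: "'i set"
  assumes M: "left_module R M" and proj: "sigma_projective R M"
  shows "rel_projective R M (direct_power M \<Lambda>)"
  unfolding rel_projective_def
proof (intro allI impI, elim conjE)
  fix L' :: "('a, 'i \<Rightarrow> 'c) module" and \<rho> \<alpha>
  let ?L = "direct_power M \<Lambda>"
  assume L': "left_module R L'" and \<rho>: "\<rho> \<in> lmod_hom R ?L L'"
    and onto: "\<rho> ` carrier ?L = carrier L'" and \<alpha>: "\<alpha> \<in> lmod_hom R M L'"
  interpret M: left_module R M by fact
  interpret L': left_module R L' by fact
  have r0: "r \<odot>\<^bsub>M\<^esub> \<zero>\<^bsub>M\<^esub> = \<zero>\<^bsub>M\<^esub>" if "r \<in> carrier R" for r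
    using M.smult_r_distr[OF that M.zero_closed M.zero_closed] that
    by (metis M.M.add.r_cancel_one' M.M.zero_closed M.M.r_zero M.smult_closed)
  have C: "x \<in> carrier (direct_power M \<Xi>) \<longleftrightarrow> x \<in> \<Xi> \<rightarrow>\<^sub>E carrier M \<and> finite {i \<in> \<Xi>. x i \<noteq> \<zero>\<^bsub>M\<^esub>}"
    for x and \<Xi> :: "'k set"
    by (simp add: direct_power_def)
  have sel: "x \<oplus>\<^bsub>direct_power M \<Xi>\<^esub> y = (\<lambda>i\<in>\<Xi>. x i \<oplus>\<^bsub>M\<^esub> y i)"
    "r \<odot>\<^bsub>direct_power M \<Xi>\<^esub> x = (\<lambda>i\<in>\<Xi>. r \<odot>\<^bsub>M\<^esub> x i)" for x y r and \<Xi> :: "'k set"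
    by (simp_all add: direct_power_def)
  define p where "p x = inv_into (carrier ?L) \<rho> (\<alpha> x)" for x
  have p: "p x \<in> carrier ?L" "\<rho> (p x) = \<alpha> x" if "x \<in> carrier M" for x
    using lmod_homD(1)[OF \<alpha> that] onto by (auto simp: p_def inv_into_into f_inv_into_f)
  define F where "F x = {i \<in> \<Lambda>. p x i \<noteq> \<zero>\<^bsub>M\<^esub>}" for x
  have finF: "finite (F x)" if "x \<in> carrier M" for x
    using p(1)[OF that] unfolding C F_def by simp
  define \<Lambda>0 where "\<Lambda>0 = (\<Union>x\<in>carrier M. F x)"
  have sub: "\<Lambda>0 \<subseteq> \<Lambda>" by (auto simp: \<Lambda>0_def F_def)
  define c where "c i = (SOME x. x \<in> carrier M \<and> i \<in> F x)" for i
  have c: "c i \<in> carrier M" "i \<in> F (c i)" if "i \<in> \<Lambda>0" for i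
    using that someI_ex[of "\<lambda>x. x \<in> carrier M \<and> i \<in> F x"] by (auto simp: \<Lambda>0_def c_def)
  define e where "e i = (c i, to_nat_on (F (c i)) i)" for i
  have inj: "inj_on e \<Lambda>0"
  proof (rule inj_onI)
    fix i j assume ij: "i \<in> \<Lambda>0" "j \<in> \<Lambda>0" "e i = e j"
    then have "c i = c j" "to_nat_on (F (c i)) i = to_nat_on (F (c i)) j" by (auto simp: e_def)
    with ij c(2)[of i] c(2)[of j] finF[OF c(1)[of i]] show "i = j"
      by (metis countable_finite to_nat_on_inj)
  qed
  let ?K = "direct_power M (e ` \<Lambda>0)"
  define \<tau> where "\<tau> y = (\<lambda>i\<in>\<Lambda>. if i \<in> \<Lambda>0 then y (e i) else \<zero>\<^bsub>M\<^esub>)" for y :: "'c \<times> nat \<Rightarrow> 'c"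
  have \<tau>_mem: "\<tau> y \<in> carrier ?L" if y: "y \<in> carrier ?K" for y
  proof -
    have "e ` {i \<in> \<Lambda>. \<tau> y i \<noteq> \<zero>\<^bsub>M\<^esub>} \<subseteq> {k \<in> e ` \<Lambda>0. y k \<noteq> \<zero>\<^bsub>M\<^esub>}"
      by (auto simp: \<tau>_def split: if_splits)
    moreover have "inj_on e {i \<in> \<Lambda>. \<tau> y i \<noteq> \<zero>\<^bsub>M\<^esub>}"
      by (rule inj_on_subset[OF inj]) (auto simp: \<tau>_def split: if_splits)
    moreover have "finite {k \<in> e ` \<Lambda>0. y k \<noteq> \<zero>\<^bsub>M\<^esub>}" using y unfolding C by simp
    ultimately have "finite {i \<in> \<Lambda>. \<tau> y i \<noteq> \<zero>\<^bsub>M\<^esub>}"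
      by (meson finite_imageD finite_subset)
    moreover have "\<tau> y \<in> \<Lambda> \<rightarrow>\<^sub>E carrier M"
    proof (rule PiE_I)
      fix i assume "i \<in> \<Lambda>"
      have "y (e i) \<in> carrier M" if "i \<in> \<Lambda>0" using y that unfolding C by blast
      then show "\<tau> y i \<in> carrier M" using \<open>i \<in> \<Lambda>\<close> by (simp add: \<tau>_def)
    qed (simp add: \<tau>_def)
    ultimately show ?thesis unfolding C by simp
  qed
  have \<tau>: "\<tau> \<in> lmod_hom R ?K ?L"
    unfolding lmod_hom_def
    by (auto simp: \<tau>_mem) (auto simp: sel \<tau>_def r0 fun_eq_iff)
  have lift_p: "\<exists>y\<in>carrier ?K. \<tau> y = p x" if x: "x \<in> carrier M" for x
  proof -
    define y where "y = (\<lambda>k\<in>e ` \<Lambda>0. p x (inv_into \<Lambda>0 e k))"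
    have ye: "y (e i) = p x i" if "i \<in> \<Lambda>0" for i
      using that by (simp add: y_def inv_into_f_f[OF inj])
    have pM: "p x \<in> \<Lambda> \<rightarrow>\<^sub>E carrier M" using p(1)[OF x] unfolding C by simp
    have "{k \<in> e ` \<Lambda>0. y k \<noteq> \<zero>\<^bsub>M\<^esub>} \<subseteq> e ` F x"
      using sub ye by (auto simp: F_def)
    then have "finite {k \<in> e ` \<Lambda>0. y k \<noteq> \<zero>\<^bsub>M\<^esub>}"
      using finF[OF x] by (meson finite_imageI finite_subset)
    moreover have "y \<in> e ` \<Lambda>0 \<rightarrow>\<^sub>E carrier M"
    proof (rule PiE_I)
      fix k assume "k \<in> e ` \<Lambda>0"
      then obtain i where "i \<in> \<Lambda>0" "k = e i" by auto
      with ye sub pM show "y k \<in> carrier M" by auto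
    qed (simp add: y_def)
    ultimately have "y \<in> carrier ?K" unfolding C by simp
    moreover have "\<tau> y = p x"
    proof
      fix i
      have "p x i = \<zero>\<^bsub>M\<^esub>" if "i \<in> \<Lambda>" "i \<notin> \<Lambda>0"
        using that x by (auto simp: \<Lambda>0_def F_def)
      moreover have "p x i = undefined" if "i \<notin> \<Lambda>"
        using pM that by auto
      ultimately show "\<tau> y i = p x i" using ye by (auto simp: \<tau>_def)
    qed
    ultimately show ?thesis by blast
  qed
  let ?I = "L'\<lparr>carrier := (\<rho> \<circ> \<tau>) ` carrier ?K\<rparr>"
  have K: "left_module R ?K" and L: "left_module R ?L"
    by (rule left_module_direct_power[OF M])+
  have hom: "\<rho> \<circ> \<tau> \<in> lmod_hom R ?K L'"
    using \<rho> \<tau> by (auto simp: lmod_hom_def Pi_iff)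
  have I: "left_module R ?I"
    by (rule left_module_epi_image[OF K, of "\<rho> \<circ> \<tau>"])
       (use lmod_homD[OF hom] lmod_hom_zero[OF hom K L'] in auto)
  have "rel_projective R M ?K"
    using proj unfolding sigma_projective_def by blast
  moreover have "\<rho> \<circ> \<tau> \<in> lmod_hom R ?K ?I"
    using hom by (auto simp: lmod_hom_def)
  moreover have "\<alpha> \<in> lmod_hom R M ?I"
  proof -
    have "\<alpha> x \<in> (\<rho> \<circ> \<tau>) ` carrier ?K" if "x \<in> carrier M" for x
      using lift_p[OF that] p(2)[OF that] by (metis comp_apply imageI)
    with \<alpha> show ?thesis by (auto simp: lmod_hom_def)
  qed
  ultimately obtain \<beta> where \<beta>: "\<beta> \<in> lmod_hom R M ?K"
      and eq: "\<forall>x\<in>carrier M. (\<rho> \<circ> \<tau>) (\<beta> x) = \<alpha> x"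
    using rel_projectiveD[OF _ K I, of M "\<rho> \<circ> \<tau>" \<alpha>] by auto
  have "\<tau> \<circ> \<beta> \<in> lmod_hom R M ?L"
    using \<tau> \<beta> by (auto simp: lmod_hom_def Pi_iff)
  with eq show "\<exists>\<beta>\<in>lmod_hom R M ?L. \<forall>x\<in>carrier M. \<rho> (\<beta> x) = \<alpha> x"
    by (intro bexI[of _ "\<tau> \<circ> \<beta>"]) auto
qed

end

theory Submission
  imports Defs "HOL-Algebra.AbelCoset"
begin

text \<open>
  Take \<open>A\<^sub>k = f\<^sub>k M\<close>, where \<open>f\<^sub>k\<close> has maximal kernel among the homomorphisms \<open>f\<close> from \<open>M\<close> to cyclic
  submodules of \<open>N\<close> that do not vanish on the fully invariant submodule \<open>Q\<close> generated by the product
  \<open>P\<close> of the earlier terms. Such \<open>f\<close> exist because \<open>\<^bold>l\<^sub>N(N) = 0\<close> gives a map \<open>M \<rightarrow> N\<close> that does not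
  vanish on \<open>P\<close>, and projectivity lifts it to the direct sum of the cyclic submodules of \<open>N\<close>.
  Maximality and nilpotency of \<open>f\<^sub>k g\<close> force \<open>f\<^sub>k g f\<^sub>k\<close> to vanish on \<open>Q\<close> for every endomorphism \<open>g\<close>.
  Homomorphisms to \<open>f\<^sub>k M\<close> factor through \<open>f\<^sub>k\<close>, so a product that starts with
  \<open>A\<^sub>1, \<dots>, A\<^sub>k\<close> is killed by a further \<open>A\<^sub>k\<close>.
\<close>

section \<open>Submodules of a left module, as sets and as modules\<close>

context left_module
begin

lemma smult_zero_right [simp]:
  assumes "r \<in> carrier R"
  shows "r \<odot>\<^bsub>M\<^esub> \<zero>\<^bsub>M\<^esub> = \<zero>\<^bsub>M\<^esub>"
  using smult_r_distr[OF assms M.zero_closed M.zero_closed] assms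
  by (metis M.add.r_cancel_one' M.zero_closed M.r_zero smult_closed)

lemma smult_a_inv:
  assumes "r \<in> carrier R" "x \<in> carrier M"
  shows "r \<odot>\<^bsub>M\<^esub> (\<ominus>\<^bsub>M\<^esub> x) = \<ominus>\<^bsub>M\<^esub> (r \<odot>\<^bsub>M\<^esub> x)"
proof -
  have "r \<odot>\<^bsub>M\<^esub> (\<ominus>\<^bsub>M\<^esub> x) \<oplus>\<^bsub>M\<^esub> r \<odot>\<^bsub>M\<^esub> x = \<zero>\<^bsub>M\<^esub>"
    using assms by (simp add: smult_r_distr[symmetric] M.l_neg)
  then show ?thesis using assms M.minus_equality by fastforce
qed

lemma submodule_facts:
  assumes "submodule H R M"
  shows "H \<subseteq> carrier M"
    and "\<zero>\<^bsub>M\<^esub> \<in> H"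
    and "x \<in> H \<Longrightarrow> y \<in> H \<Longrightarrow> x \<oplus>\<^bsub>M\<^esub> y \<in> H"
    and "x \<in> H \<Longrightarrow> \<ominus>\<^bsub>M\<^esub> x \<in> H"
    and "r \<in> carrier R \<Longrightarrow> x \<in> H \<Longrightarrow> r \<odot>\<^bsub>M\<^esub> x \<in> H"
proof -
  interpret H: submodule H R M by fact
  show "H \<subseteq> carrier M" using H.subset by simp
  show "\<zero>\<^bsub>M\<^esub> \<in> H" using H.one_closed by simp
  show "x \<in> H \<Longrightarrow> y \<in> H \<Longrightarrow> x \<oplus>\<^bsub>M\<^esub> y \<in> H" using H.m_closed by simp
  show "x \<in> H \<Longrightarrow> \<ominus>\<^bsub>M\<^esub> x \<in> H" using H.m_inv_closed by (simp add: a_inv_def)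
  show "r \<in> carrier R \<Longrightarrow> x \<in> H \<Longrightarrow> r \<odot>\<^bsub>M\<^esub> x \<in> H" by simp
qed

lemma submoduleI:
  assumes "H \<subseteq> carrier M"
    and "\<zero>\<^bsub>M\<^esub> \<in> H"
    and "\<And>x. x \<in> H \<Longrightarrow> \<ominus>\<^bsub>M\<^esub> x \<in> H"
    and "\<And>x y. \<lbrakk>x \<in> H; y \<in> H\<rbrakk> \<Longrightarrow> x \<oplus>\<^bsub>M\<^esub> y \<in> H"
    and "\<And>r x. \<lbrakk>r \<in> carrier R; x \<in> H\<rbrakk> \<Longrightarrow> r \<odot>\<^bsub>M\<^esub> x \<in> H"
  shows "submodule H R M"
  using assms by (intro submodule.intro subgroup.intro) (simp_all add: submodule_axioms_def a_inv_def)

lemma left_module_submodule: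
  assumes "submodule H R M"
  shows "left_module R (M\<lparr>carrier := H\<rparr>)"
proof -
  note H = submodule_facts[OF assms]
  have inM: "x \<in> carrier M" if "x \<in> H" for x using that H(1) by auto
  have "abelian_group (M\<lparr>carrier := H\<rparr>)"
  proof (rule abelian_groupI)
    show "\<exists>y\<in>carrier (M\<lparr>carrier := H\<rparr>). y \<oplus>\<^bsub>M\<lparr>carrier := H\<rparr>\<^esub> x = \<zero>\<^bsub>M\<lparr>carrier := H\<rparr>\<^esub>"
      if "x \<in> carrier (M\<lparr>carrier := H\<rparr>)" for x
      using that by (intro bexI[of _ "\<ominus>\<^bsub>M\<^esub> x"]) (auto simp: H inM M.l_neg)
  qed (auto simp: H inM M.a_assoc intro: M.a_comm)
  moreover have "left_module_axioms R (M\<lparr>carrier := H\<rparr>)"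
    by unfold_locales (auto simp: H inM smult_l_distr smult_r_distr smult_assoc1)
  ultimately show ?thesis
    using R.ring_axioms by (simp add: left_module_def)
qed

end

section \<open>Quotient modules and lifting along images of submodules\<close>

text \<open>\<open>Q\<close> consists of the additive cosets of \<open>K\<close>. A scalar acts on a
  coset by uniting the cosets of \<open>r x\<close> over all its elements \<open>x\<close>; these
  all coincide because \<open>K\<close> is closed under scalars, so no representative has to be
  chosen. The last clause, congruence modulo \<open>K\<close>, is how the quotient is used
  afterwards.\<close>

lemma ex_quotient_module:
  fixes L :: "('r, 'l, 'y) module_scheme"
  assumes L: "left_module R L" and K: "submodule K R L"
  shows "\<exists>(Q :: ('r, 'l set) module) \<rho>. left_module R Q \<and> \<rho> \<in> lmod_hom R L Q \<and>
    \<rho> ` carrier L = carrier Q \<and>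
    (\<forall>x\<in>carrier L. \<forall>y\<in>carrier L. \<rho> x = \<rho> y \<longleftrightarrow> x \<ominus>\<^bsub>L\<^esub> y \<in> K)"
proof -
  interpret L: left_module R L by fact
  interpret K: abelian_subgroup K L
    using K L.abelian_group_axioms
    by (intro abelian_subgroupI3) (auto simp: additive_subgroup_def submodule_def)
  note Kf = L.submodule_facts[OF K]
  define \<rho> where "\<rho> x = K +>\<^bsub>L\<^esub> x" for x
  have eq: "\<rho> x = \<rho> y \<longleftrightarrow> x \<ominus>\<^bsub>L\<^esub> y \<in> K" if "x \<in> carrier L" "y \<in> carrier L" for x y
  proof -
    have "x \<ominus>\<^bsub>L\<^esub> y \<in> K \<longleftrightarrow> x \<in> \<rho> y"
      using K.a_rcos_module[OF that(2,1)] by (simp add: \<rho>_def a_minus_def)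
    moreover have "x \<in> \<rho> y \<longleftrightarrow> \<rho> x = \<rho> y"
      using K.a_rcos_self[OF that(1)] L.a_repr_independence[OF _ that(2) K.a_subgroup, of x]
      by (auto simp: \<rho>_def)
    ultimately show ?thesis by simp
  qed
  have mem: "x \<in> carrier L \<and> \<rho> x = \<rho> y" if "y \<in> carrier L" "x \<in> \<rho> y" for x y
    using that L.a_repr_independence[OF _ that(1) K.a_subgroup, of x] K.a_elemrcos_carrier[OF that(1)]
    by (auto simp: \<rho>_def)
  define Q :: "('r, 'l set) module" where "Q =
    \<lparr>carrier = \<rho> ` carrier L, mult = undefined, one = undefined, zero = \<rho> \<zero>\<^bsub>L\<^esub>,
     add = (\<lambda>X Y. X <+>\<^bsub>L\<^esub> Y), smult = (\<lambda>r X. \<Union>x\<in>X. \<rho> (r \<odot>\<^bsub>L\<^esub> x))\<rparr>"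
  have add: "\<rho> x <+>\<^bsub>L\<^esub> \<rho> y = \<rho> (x \<oplus>\<^bsub>L\<^esub> y)" if "x \<in> carrier L" "y \<in> carrier L" for x y
    using K.a_rcos_sum[OF that] by (simp add: \<rho>_def)
  have smult: "(\<Union>z\<in>\<rho> x. \<rho> (r \<odot>\<^bsub>L\<^esub> z)) = \<rho> (r \<odot>\<^bsub>L\<^esub> x)" if "r \<in> carrier R" "x \<in> carrier L" for r x
  proof -
    have "\<rho> (r \<odot>\<^bsub>L\<^esub> z) = \<rho> (r \<odot>\<^bsub>L\<^esub> x)" if z: "z \<in> \<rho> x" for z
    proof -
      have zL: "z \<in> carrier L" and "z \<ominus>\<^bsub>L\<^esub> x \<in> K"
        using mem[OF \<open>x \<in> carrier L\<close> z] eq[of z x] \<open>x \<in> carrier L\<close> by auto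
      then have "r \<odot>\<^bsub>L\<^esub> (z \<ominus>\<^bsub>L\<^esub> x) \<in> K" using Kf(5) \<open>r \<in> carrier R\<close> by blast
      then have "r \<odot>\<^bsub>L\<^esub> z \<ominus>\<^bsub>L\<^esub> r \<odot>\<^bsub>L\<^esub> x \<in> K"
        using that zL \<open>x \<in> carrier L\<close> \<open>r \<in> carrier R\<close> by (simp add: L.minus_eq L.smult_r_distr L.smult_a_inv)
      then show ?thesis using eq zL \<open>x \<in> carrier L\<close> \<open>r \<in> carrier R\<close> by simp
    qed
    moreover have "x \<in> \<rho> x" using K.a_rcos_self[OF that(2)] by (simp add: \<rho>_def)
    ultimately show ?thesis by blast
  qed
  have "left_module R Q"
    by (rule left_module_epi_image[OF L, of \<rho>]) (auto simp: Q_def add smult)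
  moreover have "\<rho> \<in> lmod_hom R L Q"
    by (auto simp: lmod_hom_def Q_def add smult)
  ultimately show ?thesis
    using eq by (intro exI[of _ Q] exI[of _ \<rho>]) (auto simp: Q_def)
qed

text \<open>
  Relative projectivity passes to submodules: a homomorphism into an image of \<open>H \<le> L\<close> is one into
  an image of \<open>L\<close>, and its lift takes values in \<open>H\<close> because \<open>H\<close> contains the kernel.
\<close>

lemma rel_projective_submoduleD:
  fixes L :: "('r, 'l) module" and V :: "('r, 'v, 'z) module_scheme"
  assumes proj: "rel_projective R M L"
    and M: "left_module R M" and L: "left_module R L" and V: "left_module R V"
    and H: "submodule H R L"
    and \<sigma>: "\<sigma> \<in> lmod_hom R (L\<lparr>carrier := H\<rparr>) V" "\<sigma> ` H = carrier V"
    and \<alpha>: "\<alpha> \<in> lmod_hom R M V"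
  shows "\<exists>\<beta>\<in>lmod_hom R M (L\<lparr>carrier := H\<rparr>). \<forall>x\<in>carrier M. \<sigma> (\<beta> x) = \<alpha> x"
proof -
  interpret M: left_module R M by fact
  interpret L: left_module R L by fact
  interpret V: left_module R V by fact
  note Hf = L.submodule_facts[OF H]
  have HL: "x \<in> carrier L" if "x \<in> H" for x using that Hf(1) by auto
  have \<sigma>V: "\<sigma> x \<in> carrier V" if "x \<in> H" for x using that \<sigma>(2) by auto
  have \<sigma>add: "\<sigma> (x \<oplus>\<^bsub>L\<^esub> y) = \<sigma> x \<oplus>\<^bsub>V\<^esub> \<sigma> y" if "x \<in> H" "y \<in> H" for x y
    using lmod_homD(2)[OF \<sigma>(1)] that by simp
  have \<sigma>smult: "\<sigma> (r \<odot>\<^bsub>L\<^esub> x) = r \<odot>\<^bsub>V\<^esub> \<sigma> x" if "r \<in> carrier R" "x \<in> H" for r x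
    using lmod_homD(3)[OF \<sigma>(1)] that by simp
  have \<sigma>0: "\<sigma> \<zero>\<^bsub>L\<^esub> = \<zero>\<^bsub>V\<^esub>"
    using lmod_hom_zero[OF \<sigma>(1) L.left_module_submodule[OF H] V] by simp
  have \<sigma>neg: "\<sigma> (\<ominus>\<^bsub>L\<^esub> x) = \<ominus>\<^bsub>V\<^esub> \<sigma> x" if "x \<in> H" for x
  proof -
    have "\<sigma> (\<ominus>\<^bsub>L\<^esub> x) \<oplus>\<^bsub>V\<^esub> \<sigma> x = \<zero>\<^bsub>V\<^esub>"
      using \<sigma>add[of "\<ominus>\<^bsub>L\<^esub> x" x] that by (simp add: Hf HL L.l_neg \<sigma>0)
    then show ?thesis using V.minus_equality \<sigma>V that Hf(4) by metis
  qed
  \<comment> \<open>The kernel of \<open>\<sigma>\<close> is a submodule of the larger module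
    \<open>L\<close> too. With \<open>Q\<close> as \<open>L\<close> modulo \<open>K\<close>, the
    module \<open>V\<close>, being \<open>H\<close> modulo \<open>K\<close>, embeds in
    \<open>Q\<close>.\<close>
  define K where "K = {x \<in> H. \<sigma> x = \<zero>\<^bsub>V\<^esub>}"
  have K: "submodule K R L"
    by (rule L.submoduleI) (auto simp: K_def Hf HL \<sigma>0 \<sigma>neg \<sigma>add \<sigma>smult)
  obtain Q :: "('r, 'l set) module" and \<rho> where Q: "left_module R Q"
    and \<rho>: "\<rho> \<in> lmod_hom R L Q" "\<rho> ` carrier L = carrier Q"
    and eq: "\<And>x y. x \<in> carrier L \<Longrightarrow> y \<in> carrier L \<Longrightarrow> \<rho> x = \<rho> y \<longleftrightarrow> x \<ominus>\<^bsub>L\<^esub> y \<in> K"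
    using ex_quotient_module[OF L K] by metis
  define s where "s = inv_into H \<sigma>"
  have s: "s y \<in> H" "\<sigma> (s y) = y" if "y \<in> carrier V" for y
    using that \<sigma>(2) by (auto simp: s_def inv_into_into f_inv_into_f)
  \<comment> \<open>The choice \<open>s\<close> of preimages need not be additive, but two preimages
    of one element differ by an element of \<open>K\<close>. Hence \<open>\<rho> \<circ> s\<close>
    is a homomorphism, namely the embedding of \<open>V\<close> in \<open>Q\<close>.\<close>
  have \<rho>\<sigma>: "\<rho> x = \<rho> y" if "x \<in> H" "y \<in> H" "\<sigma> x = \<sigma> y" for x y
    using that by (simp add: eq HL K_def L.minus_eq Hf \<sigma>add \<sigma>neg \<sigma>V V.r_neg)
  have "(\<lambda>x. \<rho> (s (\<alpha> x))) \<in> lmod_hom R M Q"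
    unfolding lmod_hom_def
  proof (intro CollectI conjI ballI Pi_I)
    note \<alpha>D = lmod_homD[OF \<alpha>] and \<rho>D = lmod_homD[OF \<rho>(1)]
    fix x assume x: "x \<in> carrier M"
    show "\<rho> (s (\<alpha> x)) \<in> carrier Q" using x by (simp add: \<rho>D \<alpha>D s HL)
    show "\<rho> (s (\<alpha> (x \<oplus>\<^bsub>M\<^esub> y))) = \<rho> (s (\<alpha> x)) \<oplus>\<^bsub>Q\<^esub> \<rho> (s (\<alpha> y))" if y: "y \<in> carrier M" for y
    proof -
      have "\<rho> (s (\<alpha> (x \<oplus>\<^bsub>M\<^esub> y))) = \<rho> (s (\<alpha> x) \<oplus>\<^bsub>L\<^esub> s (\<alpha> y))"
        using x y by (intro \<rho>\<sigma>) (simp_all add: \<alpha>D s Hf \<sigma>add)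
      then show ?thesis using x y by (simp add: \<rho>D \<alpha>D s HL)
    qed
    show "\<rho> (s (\<alpha> (r \<odot>\<^bsub>M\<^esub> x))) = r \<odot>\<^bsub>Q\<^esub> \<rho> (s (\<alpha> x))" if r: "r \<in> carrier R" for r
    proof -
      have "\<rho> (s (\<alpha> (r \<odot>\<^bsub>M\<^esub> x))) = \<rho> (r \<odot>\<^bsub>L\<^esub> s (\<alpha> x))"
        using x r by (intro \<rho>\<sigma>) (simp_all add: \<alpha>D s Hf \<sigma>smult)
      then show ?thesis using x r by (simp add: \<rho>D \<alpha>D s HL)
    qed
  qed
  from rel_projectiveD[OF proj L Q \<rho> this] obtain \<beta> where \<beta>: "\<beta> \<in> lmod_hom R M L"
    and \<beta>eq: "\<And>x. x \<in> carrier M \<Longrightarrow> \<rho> (\<beta> x) = \<rho> (s (\<alpha> x))" by blast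
  have lift: "\<beta> x \<in> H \<and> \<sigma> (\<beta> x) = \<alpha> x" if x: "x \<in> carrier M" for x
  proof -
    let ?y = "s (\<alpha> x)"
    have y: "?y \<in> H" "\<sigma> ?y = \<alpha> x" using s lmod_homD(1)[OF \<alpha> x] by auto
    have b: "\<beta> x \<in> carrier L" using lmod_homD(1)[OF \<beta> x] .
    have d: "\<beta> x \<ominus>\<^bsub>L\<^esub> ?y \<in> K" using eq[OF b HL[OF y(1)]] \<beta>eq[OF x] by simp
    have bx: "\<beta> x = (\<beta> x \<ominus>\<^bsub>L\<^esub> ?y) \<oplus>\<^bsub>L\<^esub> ?y"
      using b HL[OF y(1)] by (simp add: L.minus_eq L.a_assoc L.l_neg)
    have "\<beta> x \<ominus>\<^bsub>L\<^esub> ?y \<in> H" "\<sigma> (\<beta> x \<ominus>\<^bsub>L\<^esub> ?y) = \<zero>\<^bsub>V\<^esub>" using d by (auto simp: K_def)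
    then have "\<sigma> (\<beta> x) = \<alpha> x" "\<beta> x \<in> H"
      using \<sigma>add[of "\<beta> x \<ominus>\<^bsub>L\<^esub> ?y" ?y] Hf(3)[of "\<beta> x \<ominus>\<^bsub>L\<^esub> ?y" ?y] y \<sigma>V[OF y(1)] bx by simp_all
    then show ?thesis by simp
  qed
  then show ?thesis
    using \<beta> by (intro bexI[of _ \<beta>]) (auto simp: lmod_hom_def)
qed

section \<open>The direct power and its sum map\<close>

lemma direct_power_sel:
  "x \<in> carrier (direct_power M \<Lambda>) \<longleftrightarrow> x \<in> \<Lambda> \<rightarrow>\<^sub>E carrier M \<and> finite {i \<in> \<Lambda>. x i \<noteq> \<zero>\<^bsub>M\<^esub>}"
  "\<zero>\<^bsub>direct_power M \<Lambda>\<^esub> = (\<lambda>i\<in>\<Lambda>. \<zero>\<^bsub>M\<^esub>)"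
  "x \<oplus>\<^bsub>direct_power M \<Lambda>\<^esub> y = (\<lambda>i\<in>\<Lambda>. x i \<oplus>\<^bsub>M\<^esub> y i)"
  "r \<odot>\<^bsub>direct_power M \<Lambda>\<^esub> x = (\<lambda>i\<in>\<Lambda>. r \<odot>\<^bsub>M\<^esub> x i)"
  by (simp_all add: direct_power_def)

text \<open>The codiagonal map. Summing over the support keeps the sum finite when
  \<open>\<Lambda>\<close> is infinite.\<close>

definition dp_sum :: "('r, 'm, 'y) module_scheme \<Rightarrow> 'i set \<Rightarrow> ('i \<Rightarrow> 'm) \<Rightarrow> 'm"
  where "dp_sum M \<Lambda> x = finsum M x {i \<in> \<Lambda>. x i \<noteq> \<zero>\<^bsub>M\<^esub>}"

context left_module
begin

lemma direct_power_minus: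
  assumes "x \<in> carrier (direct_power M \<Lambda>)"
  shows "\<ominus>\<^bsub>direct_power M \<Lambda>\<^esub> x = (\<lambda>i\<in>\<Lambda>. \<ominus>\<^bsub>M\<^esub> x i)"
proof -
  interpret P: left_module R "direct_power M \<Lambda>"
    by (rule left_module_direct_power) (rule left_module_axioms)
  have x: "x \<in> \<Lambda> \<rightarrow>\<^sub>E carrier M" "finite {i \<in> \<Lambda>. x i \<noteq> \<zero>\<^bsub>M\<^esub>}"
    using assms by (auto simp: direct_power_sel)
  have "{i \<in> \<Lambda>. (\<lambda>i\<in>\<Lambda>. \<ominus>\<^bsub>M\<^esub> x i) i \<noteq> \<zero>\<^bsub>M\<^esub>} \<subseteq> {i \<in> \<Lambda>. x i \<noteq> \<zero>\<^bsub>M\<^esub>}" by auto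
  then have "(\<lambda>i\<in>\<Lambda>. \<ominus>\<^bsub>M\<^esub> x i) \<in> carrier (direct_power M \<Lambda>)"
    using x finite_subset by (auto simp: direct_power_sel simp del: restrict_apply)
  moreover have "(\<lambda>i\<in>\<Lambda>. \<ominus>\<^bsub>M\<^esub> x i) \<oplus>\<^bsub>direct_power M \<Lambda>\<^esub> x = \<zero>\<^bsub>direct_power M \<Lambda>\<^esub>"
  proof
    fix i
    have "x i \<in> carrier M" if "i \<in> \<Lambda>" using that x(1) by blast
    then show "((\<lambda>i\<in>\<Lambda>. \<ominus>\<^bsub>M\<^esub> x i) \<oplus>\<^bsub>direct_power M \<Lambda>\<^esub> x) i = \<zero>\<^bsub>direct_power M \<Lambda>\<^esub> i"
      by (simp add: direct_power_sel M.l_neg)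
  qed
  ultimately show ?thesis using P.minus_equality assms by metis
qed

text \<open>Terms outside the support are zero. The freedom in \<open>S\<close> allows two vectors
  and their sum, whose supports differ, to be summed over one common set.\<close>

lemma dp_sum_eq:
  assumes "finite S" "{i \<in> \<Lambda>. x i \<noteq> \<zero>\<^bsub>M\<^esub>} \<subseteq> S" "S \<subseteq> \<Lambda>" "x \<in> \<Lambda> \<rightarrow> carrier M"
  shows "dp_sum M \<Lambda> x = finsum M x S"
  unfolding dp_sum_def using assms
  by (intro M.add.finprod_mono_neutral_cong_left) auto

lemma finsum_smult:
  assumes "finite S" "r \<in> carrier R" "x \<in> S \<rightarrow> carrier M"
  shows "finsum M (\<lambda>i. r \<odot>\<^bsub>M\<^esub> x i) S = r \<odot>\<^bsub>M\<^esub> finsum M x S"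
  using assms
proof (induction S)
  case (insert a S)
  have *: "x \<in> S \<rightarrow> carrier M" "x a \<in> carrier M" using insert.prems by auto
  moreover have "(\<lambda>i. r \<odot>\<^bsub>M\<^esub> x i) \<in> S \<rightarrow> carrier M" using * insert.prems by auto
  ultimately show ?case
    using insert by (simp add: M.finsum_insert smult_r_distr)
qed simp

lemma dp_sum_hom: "dp_sum M \<Lambda> \<in> lmod_hom R (direct_power M \<Lambda>) M"
  unfolding lmod_hom_def
proof (intro CollectI conjI ballI Pi_I)
  let ?P = "direct_power M \<Lambda>"
  interpret P: left_module R ?P
    by (rule left_module_direct_power) (rule left_module_axioms)
  have C: "x \<in> \<Lambda> \<rightarrow> carrier M" "finite {i \<in> \<Lambda>. x i \<noteq> \<zero>\<^bsub>M\<^esub>}" if "x \<in> carrier ?P" for x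
    using that by (auto simp: direct_power_sel)
  fix x assume x: "x \<in> carrier ?P"
  show "dp_sum M \<Lambda> x \<in> carrier M"
    using C[OF x] unfolding dp_sum_def by (intro M.finsum_closed) auto
  show "dp_sum M \<Lambda> (x \<oplus>\<^bsub>?P\<^esub> y) = dp_sum M \<Lambda> x \<oplus>\<^bsub>M\<^esub> dp_sum M \<Lambda> y" if y: "y \<in> carrier ?P" for y
  proof -
    let ?S = "{i \<in> \<Lambda>. x i \<noteq> \<zero>\<^bsub>M\<^esub>} \<union> {i \<in> \<Lambda>. y i \<noteq> \<zero>\<^bsub>M\<^esub>}"
    have fin: "finite ?S" using C[OF x] C[OF y] by simp
    have S: "x \<in> ?S \<rightarrow> carrier M" "y \<in> ?S \<rightarrow> carrier M" using C[OF x] C[OF y] by auto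
    have "dp_sum M \<Lambda> (x \<oplus>\<^bsub>?P\<^esub> y) = finsum M (x \<oplus>\<^bsub>?P\<^esub> y) ?S"
      using C(1)[OF P.a_closed[OF x y]] fin by (intro dp_sum_eq) (auto simp: direct_power_sel)
    also have "\<dots> = finsum M (\<lambda>i. x i \<oplus>\<^bsub>M\<^esub> y i) ?S"
      using S by (intro M.finsum_cong') (auto simp: direct_power_sel)
    also have "\<dots> = finsum M x ?S \<oplus>\<^bsub>M\<^esub> finsum M y ?S"
      by (rule M.finsum_addf[OF S])
    also have "finsum M x ?S = dp_sum M \<Lambda> x"
      using C[OF x] fin by (intro dp_sum_eq[symmetric]) auto
    also have "finsum M y ?S = dp_sum M \<Lambda> y"
      using C[OF y] fin by (intro dp_sum_eq[symmetric]) auto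
    finally show ?thesis .
  qed
  show "dp_sum M \<Lambda> (r \<odot>\<^bsub>?P\<^esub> x) = r \<odot>\<^bsub>M\<^esub> dp_sum M \<Lambda> x" if r: "r \<in> carrier R" for r
  proof -
    let ?S = "{i \<in> \<Lambda>. x i \<noteq> \<zero>\<^bsub>M\<^esub>}"
    have S: "x \<in> ?S \<rightarrow> carrier M" using C[OF x] by auto
    have "dp_sum M \<Lambda> (r \<odot>\<^bsub>?P\<^esub> x) = finsum M (r \<odot>\<^bsub>?P\<^esub> x) ?S"
      using C(1)[OF P.smult_closed[OF r x]] C(2)[OF x] r by (intro dp_sum_eq) (auto simp: direct_power_sel)
    also have "\<dots> = finsum M (\<lambda>i. r \<odot>\<^bsub>M\<^esub> x i) ?S"
      using S r by (intro M.finsum_cong') (auto simp: direct_power_sel)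
    also have "\<dots> = r \<odot>\<^bsub>M\<^esub> finsum M x ?S"
      by (rule finsum_smult[OF C(2)[OF x] r S])
    finally show ?thesis by (simp add: dp_sum_def)
  qed
qed

lemma dp_sum_single:
  assumes "v \<in> \<Lambda>" "m \<in> carrier M"
  shows "(\<lambda>i\<in>\<Lambda>. if i = v then m else \<zero>\<^bsub>M\<^esub>) \<in> carrier (direct_power M \<Lambda>)"
    and "dp_sum M \<Lambda> (\<lambda>i\<in>\<Lambda>. if i = v then m else \<zero>\<^bsub>M\<^esub>) = m"
proof -
  let ?x = "\<lambda>i\<in>\<Lambda>. if i = v then m else \<zero>\<^bsub>M\<^esub>"
  have sub: "{i \<in> \<Lambda>. ?x i \<noteq> \<zero>\<^bsub>M\<^esub>} \<subseteq> {v}" by auto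
  show "?x \<in> carrier (direct_power M \<Lambda>)"
    using assms finite_subset[OF sub] by (auto simp: direct_power_sel)
  have "dp_sum M \<Lambda> ?x = finsum M ?x {v}"
    using assms sub by (intro dp_sum_eq) auto
  then show "dp_sum M \<Lambda> ?x = m"
    using assms by (simp add: M.finsum_insert)
qed

section \<open>Endomorphisms, their images, and cyclic submodules\<close>

lemma hom_into_iff:
  assumes "K \<subseteq> carrier M"
  shows "f \<in> hom_into R M K \<longleftrightarrow> f \<in> lmod_End R M \<and> f ` carrier M \<subseteq> K"
  using assms by (auto simp: lmod_hom_def)

lemma End_comp:
  assumes "f \<in> lmod_End R M" "g \<in> lmod_End R M"
  shows "f \<circ> g \<in> lmod_End R M"
  using assms by (auto simp: lmod_hom_def Pi_iff)

lemma End_id: "id \<in> lmod_End R M"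
  by (auto simp: lmod_hom_def)

lemma End_zero:
  assumes "f \<in> lmod_End R M"
  shows "f \<zero>\<^bsub>M\<^esub> = \<zero>\<^bsub>M\<^esub>"
  using lmod_hom_zero[OF assms left_module_axioms left_module_axioms] .

lemma End_neg:
  assumes "f \<in> lmod_End R M" "x \<in> carrier M"
  shows "f (\<ominus>\<^bsub>M\<^esub> x) = \<ominus>\<^bsub>M\<^esub> f x"
proof -
  have "f (\<ominus>\<^bsub>M\<^esub> x) \<oplus>\<^bsub>M\<^esub> f x = \<zero>\<^bsub>M\<^esub>"
    using lmod_homD(2)[OF assms(1), of "\<ominus>\<^bsub>M\<^esub> x" x] assms by (simp add: M.l_neg End_zero)
  then show ?thesis using M.minus_equality assms lmod_homD(1)[OF assms(1)] by fastforce
qed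

lemma submodule_image:
  assumes "f \<in> lmod_End R M"
  shows "submodule (f ` carrier M) R M"
proof (rule submoduleI)
  note fD = lmod_homD[OF assms]
  show "\<zero>\<^bsub>M\<^esub> \<in> f ` carrier M" using End_zero[OF assms] by (metis M.zero_closed imageI)
  show "f ` carrier M \<subseteq> carrier M" using fD(1) by auto
  show "\<ominus>\<^bsub>M\<^esub> x \<in> f ` carrier M" if "x \<in> f ` carrier M" for x
    using that by (auto simp: End_neg[OF assms, symmetric])
  show "x \<oplus>\<^bsub>M\<^esub> y \<in> f ` carrier M" if "x \<in> f ` carrier M" "y \<in> f ` carrier M" for x y
    using that by (auto simp: fD(2)[symmetric])
  show "r \<odot>\<^bsub>M\<^esub> x \<in> f ` carrier M" if "r \<in> carrier R" "x \<in> f ` carrier M" for r x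
    using that by (auto simp: fD(3)[symmetric])
qed

lemma cyclic_submodule:
  assumes "n \<in> carrier M"
  shows "submodule (cyclic_submodule R M n) R M" and "n \<in> cyclic_submodule R M n"
proof -
  have z: "\<zero>\<^bsub>R\<^esub> \<odot>\<^bsub>M\<^esub> n = \<zero>\<^bsub>M\<^esub>"
    using smult_l_distr[OF R.zero_closed R.zero_closed assms] assms
    by (metis M.add.r_cancel_one' R.zero_closed R.r_zero smult_closed)
  have neg: "\<ominus>\<^bsub>M\<^esub> (r \<odot>\<^bsub>M\<^esub> n) = (\<ominus>\<^bsub>R\<^esub> r) \<odot>\<^bsub>M\<^esub> n" if "r \<in> carrier R" for r
  proof -
    have "(\<ominus>\<^bsub>R\<^esub> r) \<odot>\<^bsub>M\<^esub> n \<oplus>\<^bsub>M\<^esub> r \<odot>\<^bsub>M\<^esub> n = \<zero>\<^bsub>M\<^esub>"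
      using that assms by (simp add: smult_l_distr[symmetric] R.l_neg z)
    then show ?thesis using M.minus_equality that assms by fastforce
  qed
  show "submodule (cyclic_submodule R M n) R M"
  proof (rule submoduleI)
    show "\<zero>\<^bsub>M\<^esub> \<in> cyclic_submodule R M n"
      unfolding cyclic_submodule_def using z by (metis R.zero_closed imageI)
  qed (use assms in \<open>auto simp: cyclic_submodule_def neg smult_l_distr[symmetric] smult_assoc1[symmetric]\<close>)
  show "n \<in> cyclic_submodule R M n"
    unfolding cyclic_submodule_def using assms by (metis R.one_closed imageI smult_one)
qed

section \<open>Two consequences of projectivity\<close>

text \<open>\<open>f\<close> is an epimorphism onto its image, and \<open>M\<close> is projective
  relative to itself: the direct power over the one-element index set \<open>{()}\<close> is a copy
  of \<open>M\<close>.\<close>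

lemma sigma_projective_factor:
  assumes proj: "sigma_projective R M"
    and f: "f \<in> lmod_End R M" and g: "g \<in> hom_into R M (f ` carrier M)"
  shows "\<exists>g'\<in>lmod_End R M. \<forall>x\<in>carrier M. g x = f (g' x)"
proof -
  let ?P = "direct_power M {()}" and ?V = "M\<lparr>carrier := f ` carrier M\<rparr>"
  note M = left_module_axioms
  have V: "left_module R ?V" by (rule left_module_submodule[OF submodule_image[OF f]])
  have \<rho>: "(\<lambda>x. f (x ())) \<in> lmod_hom R ?P ?V"
    using lmod_homD[OF f] by (auto simp: lmod_hom_def direct_power_sel PiE_iff)
  have "(\<lambda>x. f (x ())) ` carrier ?P = carrier ?V"
  proof -
    have "f m \<in> (\<lambda>x. f (x ())) ` carrier ?P" if "m \<in> carrier M" for m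
      using that by (intro image_eqI[of _ _ "\<lambda>i\<in>{()}. m"]) (auto simp: direct_power_sel)
    then show ?thesis using lmod_homD(1)[OF \<rho>] by auto
  qed
  from rel_projectiveD[OF sigma_projectiveD[OF M proj] left_module_direct_power[OF M] V \<rho> this g]
  obtain \<beta> where \<beta>: "\<beta> \<in> lmod_hom R M ?P" "\<forall>x\<in>carrier M. f (\<beta> x ()) = g x" by blast
  have "(\<lambda>x. \<beta> x ()) \<in> lmod_End R M"
    using lmod_homD[OF \<beta>(1)] by (auto simp: lmod_hom_def direct_power_sel)
  with \<beta>(2) show ?thesis by (intro bexI[of _ "\<lambda>x. \<beta> x ()"]) auto
qed

text \<open>
  The sum map from the direct sum of the cyclic submodules of \<open>N\<close> onto \<open>N\<close> lifts every
  homomorphism to \<open>N\<close>, and one of the components of the lift does not vanish at \<open>p\<close>.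
\<close>

lemma sigma_projective_hom_into_cyclic:
  assumes proj: "sigma_projective R M" and N: "submodule N R M"
    and f: "f \<in> hom_into R M N" and p: "p \<in> carrier M" "f p \<noteq> \<zero>\<^bsub>M\<^esub>"
  shows "\<exists>n\<in>N. \<exists>g\<in>hom_into R M (cyclic_submodule R M n). g p \<noteq> \<zero>\<^bsub>M\<^esub>"
proof -
  let ?P = "direct_power M N" and ?V = "M\<lparr>carrier := N\<rparr>"
  note M = left_module_axioms
  note Nf = submodule_facts[OF N]
  have P: "left_module R ?P" by (rule left_module_direct_power[OF M])
  interpret P: left_module R ?P by (rule P)
  \<comment> \<open>The direct sum of the cyclic submodules \<open>R n\<close>, realised inside the
    direct power with index set \<open>N\<close>: each \<open>n\<close> indexes the submodule that
    it generates.\<close>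
  define H where "H = {x \<in> carrier ?P. \<forall>n\<in>N. x n \<in> cyclic_submodule R M n}"
  have cyc: "submodule (cyclic_submodule R M n) R M" "n \<in> cyclic_submodule R M n" if "n \<in> N" for n
    using cyclic_submodule that Nf(1) by auto
  have cycN: "cyclic_submodule R M n \<subseteq> N" if "n \<in> N" for n
    using that Nf(5) by (auto simp: cyclic_submodule_def)
  have H: "submodule H R ?P"
  proof (rule P.submoduleI)
    show "H \<subseteq> carrier ?P" by (auto simp: H_def)
    show "\<zero>\<^bsub>?P\<^esub> \<in> H" unfolding H_def using P.zero_closed submodule_facts(2)[OF cyc(1)]
      by (auto simp: direct_power_sel(2))
    show "\<ominus>\<^bsub>?P\<^esub> x \<in> H" if x: "x \<in> H" for x
    proof -
      have xP: "x \<in> carrier ?P" using x by (simp add: H_def)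
      then show ?thesis
        using P.a_inv_closed[OF xP] x submodule_facts(4)[OF cyc(1)]
        by (auto simp: H_def direct_power_minus)
    qed
    show "x \<oplus>\<^bsub>?P\<^esub> y \<in> H" if "x \<in> H" "y \<in> H" for x y
      using that P.a_closed[of x y] submodule_facts(3)[OF cyc(1)]
      by (auto simp: H_def direct_power_sel(3))
    show "r \<odot>\<^bsub>?P\<^esub> x \<in> H" if "r \<in> carrier R" "x \<in> H" for r x
      using that P.smult_closed[of r x] submodule_facts(5)[OF cyc(1)]
      by (auto simp: H_def direct_power_sel(4))
  qed
  have sumN: "dp_sum M N x \<in> N" if x: "x \<in> H" for x
  proof -
    let ?S = "{i \<in> N. x i \<noteq> \<zero>\<^bsub>M\<^esub>}"
    have "finsum M x S \<in> N" if "finite S" "S \<subseteq> N" for S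
      using that
    proof (induction S)
      case (insert a S)
      have xN: "x i \<in> N" if "i \<in> N" for i using x that cycN by (auto simp: H_def)
      then have "x \<in> S \<rightarrow> carrier M" "x a \<in> carrier M" using insert Nf(1) by auto
      then show ?case using insert xN Nf(3) by (simp add: M.finsum_insert)
    qed (simp add: Nf)
    moreover have "finite ?S" using x by (simp add: H_def direct_power_sel)
    ultimately show ?thesis by (simp add: dp_sum_def)
  qed
  have \<sigma>: "dp_sum M N \<in> lmod_hom R (?P\<lparr>carrier := H\<rparr>) ?V"
    using lmod_homD[OF dp_sum_hom[of N]] sumN by (auto simp: lmod_hom_def H_def)
  have onto: "dp_sum M N ` H = carrier ?V"
  proof -
    have "v \<in> dp_sum M N ` H" if v: "v \<in> N" for v
    proof -
      have vM: "v \<in> carrier M" using v Nf(1) by auto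
      \<comment> \<open>The vector with entry \<open>v\<close> at the index \<open>v\<close> belongs
        to \<open>H\<close> because \<open>v\<close> lies in \<open>R v\<close>, and its sum is
        \<open>v\<close>.\<close>
      let ?x = "\<lambda>i\<in>N. if i = v then v else \<zero>\<^bsub>M\<^esub>"
      have "?x \<in> H"
        using dp_sum_single(1)[OF v vM] cyc submodule_facts(2)[OF cyc(1)] by (auto simp: H_def)
      then show ?thesis using dp_sum_single(2)[OF v vM] by (metis imageI)
    qed
    then show ?thesis using sumN by auto
  qed
  obtain \<beta> where \<beta>: "\<beta> \<in> lmod_hom R M (?P\<lparr>carrier := H\<rparr>)"
    and eq: "\<And>x. x \<in> carrier M \<Longrightarrow> dp_sum M N (\<beta> x) = f x"
    using rel_projective_submoduleD[OF sigma_projectiveD[OF M proj] M P left_module_submodule[OF N] H \<sigma> onto f]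
    by blast
  have "\<exists>n\<in>N. \<beta> p n \<noteq> \<zero>\<^bsub>M\<^esub>"
  proof (rule ccontr)
    assume "\<not> ?thesis"
    then have "{i \<in> N. \<beta> p i \<noteq> \<zero>\<^bsub>M\<^esub>} = {}" by auto
    then have "dp_sum M N (\<beta> p) = \<zero>\<^bsub>M\<^esub>" unfolding dp_sum_def by (simp only: M.finsum_empty)
    then show False using eq[OF p(1)] p(2) by simp
  qed
  then obtain n where n: "n \<in> N" "\<beta> p n \<noteq> \<zero>\<^bsub>M\<^esub>" by blast
  have "(\<lambda>x. \<beta> x n) \<in> hom_into R M (cyclic_submodule R M n)"
    using lmod_homD[OF \<beta>] n(1) by (auto simp: lmod_hom_def direct_power_sel H_def)
  with n show ?thesis by (intro bexI[of _ n] bexI[of _ "\<lambda>x. \<beta> x n"]) auto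
qed

end

section \<open>Membership in products and upper bounds for them\<close>

context left_module
begin

lemma zero_in_mprod: "\<zero>\<^bsub>M\<^esub> \<in> mprod R M A B"
  unfolding mprod_def submodule_Sum_def
  by (intro CollectI exI[of _ "\<lambda>_. \<zero>\<^bsub>M\<^esub>"] exI[of _ "{}"]) simp

lemma hom_image_in_mprod:
  assumes f: "f \<in> hom_into R M B" and "B \<subseteq> carrier M" "A \<subseteq> carrier M" and x: "x \<in> A"
  shows "f x \<in> mprod R M A B"
proof -
  have "f x \<in> carrier M" using assms lmod_homD(1)[OF f] by auto
  then have "f x = finsum M (\<lambda>_. f x) {f ` A}" by (simp add: M.finsum_insert)
  then show ?thesis
    unfolding mprod_def submodule_Sum_def using f x
    by (intro CollectI exI[of _ "\<lambda>_. f x"] exI[of _ "{f ` A}"]) auto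
qed

text \<open>Elements of the product are finite sums of values \<open>f x\<close>, so induction on
  the number of summands suffices. \<open>K\<close> will be an image, a kernel or zero.\<close>

lemma mprod_subset:
  assumes K: "K \<subseteq> carrier M" "\<zero>\<^bsub>M\<^esub> \<in> K" "\<And>x y. x \<in> K \<Longrightarrow> y \<in> K \<Longrightarrow> x \<oplus>\<^bsub>M\<^esub> y \<in> K"
    and hom: "\<And>f x. f \<in> hom_into R M B \<Longrightarrow> x \<in> A \<Longrightarrow> f x \<in> K"
  shows "mprod R M A B \<subseteq> K"
proof
  fix z assume "z \<in> mprod R M A B"
  then obtain x \<G> where z: "z = finsum M x \<G>" and fin: "finite \<G>"
    and \<G>: "\<G> \<subseteq> {f ` A | f. f \<in> hom_into R M B}" "\<forall>C\<in>\<G>. x C \<in> C"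
    unfolding mprod_def submodule_Sum_def by auto
  have "x C \<in> K" if "C \<in> \<G>" for C
  proof -
    obtain f where f: "f \<in> hom_into R M B" "C = f ` A" using \<G>(1) \<open>C \<in> \<G>\<close> by auto
    then obtain a where "a \<in> A" "x C = f a" using \<G>(2) \<open>C \<in> \<G>\<close> by auto
    then show ?thesis using hom[OF f(1)] by simp
  qed
  with fin have "finsum M x \<G> \<in> K"
  proof (induction \<G>)
    case (insert C \<G>)
    then have "x \<in> \<G> \<rightarrow> carrier M" "x C \<in> carrier M" using K(1) by auto
    with insert K(3) show ?case by (simp add: M.finsum_insert)
  qed (simp add: K(2))
  then show "z \<in> K" by (simp add: z)
qed

section \<open>Maximal kernels and maps whose square vanishes\<close>

text \<open>A kernel is the annihilator of a one-element set. If every kernel in \<open>F\<close>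
  were properly contained in another, dependent choice would give a strictly ascending chain of such
  annihilators.\<close>

lemma acc_annihilators_maximal_kernel:
  assumes acc: "acc_annihilators R M" and F: "F \<subseteq> lmod_End R M" "F \<noteq> {}"
  shows "\<exists>f\<in>F. \<forall>g\<in>F. ker_Inter M {f} \<subseteq> ker_Inter M {g} \<longrightarrow> ker_Inter M {g} = ker_Inter M {f}"
proof (rule ccontr)
  assume "\<not> ?thesis"
  then have step: "\<exists>g\<in>F. ker_Inter M {f} \<subset> ker_Inter M {g}" if "f \<in> F" for f
    using that by blast
  obtain h where h: "\<And>i. h i \<in> F" "\<And>i :: nat. ker_Inter M {h i} \<subset> ker_Inter M {h (Suc i)}"
    using dependent_nat_choice[of "\<lambda>_ f. f \<in> F" "\<lambda>_ f g. ker_Inter M {f} \<subset> ker_Inter M {g}"] F(2) step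
    by (metis ex_in_conv)
  have "\<exists>n. \<forall>m\<ge>n. ker_Inter M {h m} = ker_Inter M {h n}"
    using acc[unfolded acc_annihilators_def, rule_format, of "\<lambda>i. {h i}"] h F(1) by blast
  then obtain n where "ker_Inter M {h (Suc n)} = ker_Inter M {h n}" by (meson le_SucI order_refl)
  with h(2)[of n] show False by simp
qed

text \<open>
  Otherwise let \<open>k\<close> be the last exponent for which \<open>(f g)\<^sup>k f\<close> does not vanish on \<open>Q\<close>; its kernel is
  that of \<open>f\<close> by maximality, while it annihilates \<open>g f Q\<close>.
\<close>

lemma maximal_kernel_square_zero:
  assumes nil: "\<And>h. h \<in> hom_into R M C \<Longrightarrow> nilpotent_on M h"
    and C: "C \<subseteq> carrier M" and f: "f \<in> hom_into R M C" and g: "g \<in> lmod_End R M"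
    and Q: "Q \<subseteq> carrier M" and q: "q \<in> Q"
    and max: "\<And>u. \<lbrakk>u \<in> hom_into R M C; \<exists>q\<in>Q. u q \<noteq> \<zero>\<^bsub>M\<^esub>; ker_Inter M {f} \<subseteq> ker_Inter M {u}\<rbrakk>
      \<Longrightarrow> ker_Inter M {u} = ker_Inter M {f}"
  shows "f (g (f q)) = \<zero>\<^bsub>M\<^esub>"
proof (rule ccontr)
  assume nz: "f (g (f q)) \<noteq> \<zero>\<^bsub>M\<^esub>"
  define h where "h = f \<circ> g"
  have fE: "f \<in> lmod_End R M" "f ` carrier M \<subseteq> C" using f hom_into_iff[OF C] by auto
  have hE: "h \<in> lmod_End R M" using End_comp[OF fE(1) g] by (simp add: h_def)
  have hC: "h ` carrier M \<subseteq> C" using fE lmod_homD(1)[OF g] by (auto simp: h_def)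
  have pow: "h ^^ k \<in> lmod_End R M" for k
  proof (induction k)
    case (Suc k)
    then show ?case using End_comp[OF hE Suc] by (simp only: funpow.simps)
  qed (use End_id in \<open>simp add: id_def\<close>)
  \<comment> \<open>\<open>f\<close> is both the leftmost and the rightmost factor of
    \<open>(f g)^k f\<close>: the image lies in \<open>C\<close> and the kernel contains that of
    \<open>f\<close>. Maximality thus applies whenever this map does not vanish on
    \<open>Q\<close>.\<close>
  have uC: "h ^^ k \<circ> f \<in> hom_into R M C" for k
    unfolding hom_into_iff[OF C]
  proof
    show "h ^^ k \<circ> f \<in> lmod_End R M" by (rule End_comp[OF pow fE(1)])
    show "(h ^^ k \<circ> f) ` carrier M \<subseteq> C"
    proof (cases k)
      case (Suc j)
      then show ?thesis using hC lmod_homD(1)[OF pow] lmod_homD(1)[OF fE(1)] by auto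
    qed (use fE in auto)
  qed
  have ker: "ker_Inter M {f} \<subseteq> ker_Inter M {h ^^ k \<circ> f}" for k
    using End_zero[OF pow] by (auto simp: ker_Inter_def)
  define V where "V k \<longleftrightarrow> (\<forall>q\<in>Q. (h ^^ k) (f q) = \<zero>\<^bsub>M\<^esub>)" for k
  \<comment> \<open>\<open>h = f g\<close> maps into \<open>C\<close> as well, so it is nilpotent,
    and some \<open>V m\<close> holds.\<close>
  obtain m where m: "\<forall>x\<in>carrier M. (h ^^ m) x = \<zero>\<^bsub>M\<^esub>"
    using nil[of h] hE hC hom_into_iff[OF C] by (auto simp: nilpotent_on_def)
  then have "V m" using Q lmod_homD(1)[OF fE(1)] by (auto simp: V_def)
  \<comment> \<open>Indeed \<open>h (f q) = f (g (f q))\<close>. As \<open>V 0\<close> would imply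
    \<open>V 1\<close>, the least exponent \<open>l\<close> is a successor \<open>Suc k\<close>, and
    \<open>k\<close> is the exponent sought.\<close>
  have "\<not> V 1" using nz q by (auto simp: V_def h_def)
  define l where "l = (LEAST k. V k)"
  have "V l" unfolding l_def by (rule LeastI[of V, OF \<open>V m\<close>])
  have "l \<noteq> 0"
  proof
    assume "l = 0"
    with \<open>V l\<close> have "V 1" using End_zero[OF hE] by (auto simp: V_def)
    with \<open>\<not> V 1\<close> show False by simp
  qed
  then obtain k where k: "l = Suc k" by (cases l) auto
  then have "\<not> V k" using not_less_Least[of k V] by (simp add: l_def)
  then have "ker_Inter M {h ^^ k \<circ> f} = ker_Inter M {f}"
    using max[OF uC _ ker, of k] by (auto simp: V_def)
  moreover have "g (f q) \<in> ker_Inter M {h ^^ k \<circ> f}"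
  proof -
    have "(h ^^ Suc k) (f q) = \<zero>\<^bsub>M\<^esub>" using \<open>V l\<close> q k by (auto simp: V_def)
    then have "(h ^^ k) (f (g (f q))) = \<zero>\<^bsub>M\<^esub>" by (simp add: funpow_swap1 h_def)
    then show ?thesis
      using q Q lmod_homD(1)[OF g] lmod_homD(1)[OF fE(1)] by (auto simp: ker_Inter_def)
  qed
  ultimately show False using nz by (simp add: ker_Inter_def)
qed

text \<open>One step of the construction, with \<open>P\<close> the product of the terms found so
  far. The nonzero \<open>p\<close> in \<open>N\<close> supplies a first map that does not vanish on
  \<open>P\<close>; a map of maximal kernel then has the required properties.\<close>

lemma ex_square_zero_hom:
  assumes proj: "sigma_projective R M" and nil: "nil_submodule R M N"
    and ann: "l_ann R M N N = {\<zero>\<^bsub>M\<^esub>}" and acc: "acc_annihilators R M"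
    and P: "P \<subseteq> carrier M" and p: "p \<in> P" "p \<in> N" "p \<noteq> \<zero>\<^bsub>M\<^esub>"
  shows "\<exists>f\<in>lmod_End R M. f ` carrier M \<subseteq> N \<and> (\<exists>s\<in>lmod_End R M. \<exists>p\<in>P. f (s p) \<noteq> \<zero>\<^bsub>M\<^esub>) \<and>
    (\<forall>s\<in>lmod_End R M. \<forall>t\<in>lmod_End R M. \<forall>p\<in>P. f (s (f (t p))) = \<zero>\<^bsub>M\<^esub>)"
proof -
  have N: "submodule N R M" using nil by (simp add: nil_submodule_def)
  note Nf = submodule_facts[OF N]
  have cyc: "cyclic_submodule R M n \<subseteq> N" if "n \<in> N" for n
    using that Nf(5) by (auto simp: cyclic_submodule_def)
  \<comment> \<open>These are generators of the fully invariant submodule generated by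
    \<open>P\<close>; a homomorphism vanishes on them iff it vanishes on that submodule.\<close>
  define Q where "Q = {s p | s p. s \<in> lmod_End R M \<and> p \<in> P}"
  have PQ: "P \<subseteq> Q"
  proof
    fix x assume "x \<in> P"
    then show "x \<in> Q" unfolding Q_def using End_id by (intro CollectI exI[of _ id] exI[of _ x]) simp
  qed
  have Q: "Q \<subseteq> carrier M" unfolding Q_def using P by (auto dest: lmod_homD(1))
  \<comment> \<open>Maps to all the cyclic submodules compete together. Once \<open>f\<close> is
    chosen, its \<open>n\<close> is fixed, and every map to the same \<open>R n\<close> that does
    not vanish on \<open>Q\<close> is among the competitors, as the square-zero argument
    demands.\<close>
  define F where "F = {f. \<exists>n\<in>N. f \<in> hom_into R M (cyclic_submodule R M n) \<and> (\<exists>q\<in>Q. f q \<noteq> \<zero>\<^bsub>M\<^esub>)}"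
  have FE: "f \<in> lmod_End R M \<and> f ` carrier M \<subseteq> cyclic_submodule R M n"
    if "f \<in> hom_into R M (cyclic_submodule R M n)" "n \<in> N" for f n
    using that cyc[OF that(2)] Nf(1) hom_into_iff[of "cyclic_submodule R M n"] by blast
  have "p \<notin> Ann R M N" using ann p by (auto simp: l_ann_def)
  then obtain f0 where f0: "f0 \<in> hom_into R M N" "f0 p \<noteq> \<zero>\<^bsub>M\<^esub>"
    using p P by (auto simp: Ann_def ker_Inter_def)
  have "F \<noteq> {}"
    using sigma_projective_hom_into_cyclic[OF proj N f0(1) _ f0(2)] p(1) P PQ by (auto simp: F_def)
  moreover have "F \<subseteq> lmod_End R M" using FE by (auto simp: F_def)
  ultimately obtain f where f: "f \<in> F"
    and max: "\<And>u. u \<in> F \<Longrightarrow> ker_Inter M {f} \<subseteq> ker_Inter M {u} \<Longrightarrow> ker_Inter M {u} = ker_Inter M {f}"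
    using acc_annihilators_maximal_kernel[OF acc] by metis
  then obtain n q where n: "n \<in> N" and fn: "f \<in> hom_into R M (cyclic_submodule R M n)"
    and q: "q \<in> Q" "f q \<noteq> \<zero>\<^bsub>M\<^esub>" by (auto simp: F_def)
  have zero: "f (s (f q)) = \<zero>\<^bsub>M\<^esub>" if "s \<in> lmod_End R M" "q \<in> Q" for s q
  proof (rule maximal_kernel_square_zero[OF _ _ fn that(1) Q that(2)])
    show "nilpotent_on M h" if "h \<in> hom_into R M (cyclic_submodule R M n)" for h
      using nil n that by (simp add: nil_submodule_def)
    show "cyclic_submodule R M n \<subseteq> carrier M" using cyc n Nf(1) by auto
    show "ker_Inter M {u} = ker_Inter M {f}"
      if "u \<in> hom_into R M (cyclic_submodule R M n)" "\<exists>q\<in>Q. u q \<noteq> \<zero>\<^bsub>M\<^esub>"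
        "ker_Inter M {f} \<subseteq> ker_Inter M {u}" for u
      using that n by (intro max) (auto simp: F_def)
  qed
  have "f \<in> lmod_End R M" "f ` carrier M \<subseteq> N" using FE[OF fn n] cyc[OF n] by auto
  moreover have "\<exists>s\<in>lmod_End R M. \<exists>p\<in>P. f (s p) \<noteq> \<zero>\<^bsub>M\<^esub>" using q by (auto simp: Q_def)
  moreover have "f (s (f (t p))) = \<zero>\<^bsub>M\<^esub>" if "s \<in> lmod_End R M" "t \<in> lmod_End R M" "p \<in> P" for s t p
    using that by (intro zero) (auto simp: Q_def)
  ultimately show ?thesis by blast
qed

section \<open>Products whose right factor is the image of an endomorphism\<close>

text \<open>Homomorphisms into the image take values there, and \<open>f\<close> itself is one of
  them. This lets the recursion for the products start at the whole module.\<close>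

lemma mprod_carrier_image:
  assumes f: "f \<in> lmod_End R M"
  shows "mprod R M (carrier M) (f ` carrier M) = f ` carrier M"
proof
  have B: "f ` carrier M \<subseteq> carrier M" using lmod_homD(1)[OF f] by auto
  note S = submodule_facts[OF submodule_image[OF f]]
  show "mprod R M (carrier M) (f ` carrier M) \<subseteq> f ` carrier M"
    by (rule mprod_subset[OF B S(2,3)]) (auto dest: lmod_homD(1))
  have "f \<in> hom_into R M (f ` carrier M)" using hom_into_iff[OF B] f by auto
  then show "f ` carrier M \<subseteq> mprod R M (carrier M) (f ` carrier M)"
    using hom_image_in_mprod[OF _ B] by auto
qed

text \<open>Homomorphisms into \<open>f M\<close> factor as \<open>f \<circ> s\<close>, since \<open>M\<close> is \<open>M\<close>-projective.\<close>

lemma mprod_image_subset: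
  assumes proj: "sigma_projective R M" and f: "f \<in> lmod_End R M" and A: "A \<subseteq> carrier M"
    and K: "K \<subseteq> carrier M" "\<zero>\<^bsub>M\<^esub> \<in> K" "\<And>x y. x \<in> K \<Longrightarrow> y \<in> K \<Longrightarrow> x \<oplus>\<^bsub>M\<^esub> y \<in> K"
    and sub: "\<And>s x. s \<in> lmod_End R M \<Longrightarrow> x \<in> A \<Longrightarrow> f (s x) \<in> K"
  shows "mprod R M A (f ` carrier M) \<subseteq> K"
proof (rule mprod_subset[OF K])
  fix g x assume g: "g \<in> hom_into R M (f ` carrier M)" and x: "x \<in> A"
  obtain s where "s \<in> lmod_End R M" "\<forall>x\<in>carrier M. g x = f (s x)"
    using sigma_projective_factor[OF proj f g] by blast
  then show "g x \<in> K" using sub x A by auto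
qed

end

section \<open>Construction of the sequence\<close>

theorem proposition4p13:
  fixes R :: "('r, 'x) ring_scheme" and M :: "('r, 'm, 'y) module_scheme" and N :: "'m set"
  assumes "left_module R M"
    and "sigma_projective R M"
    and "submodule N R M" and "N \<noteq> carrier M" and "N \<noteq> {\<zero>\<^bsub>M\<^esub>}"
    and "fully_invariant R M N"
    and "nil_submodule R M N"
    and "\<And>j. j > 0 \<Longrightarrow> l_ann R M N (mpower R M N j) = {\<zero>\<^bsub>M\<^esub>}"
    and "acc_annihilators R M"
  shows "\<exists>A :: nat \<Rightarrow> 'm set.
    (\<forall>i>0. submodule (A i) R M \<and> A i \<subseteq> N) \<and>
    (\<forall>k>0. mprod_seq R M A k \<noteq> {\<zero>\<^bsub>M\<^esub>}) \<and>
    (\<forall>k n. 0 < n \<and> n \<le> k \<longrightarrow> mprod R M (mprod_seq R M A k) (A n) = {\<zero>\<^bsub>M\<^esub>})"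
proof -
  interpret left_module R M by fact
  note proj = assms(2)
  note Nf = submodule_facts[OF assms(3)]
  have ann: "l_ann R M N N = {\<zero>\<^bsub>M\<^esub>}" using assms(8)[of 1] by simp
  \<comment> \<open>The existential clause keeps the product of \<open>P\<close> with the image of
    \<open>f\<close> nonzero; the universal clause makes a second factor \<open>f\<close> kill it,
    whatever endomorphism stands between.\<close>
  define good where "good P f \<longleftrightarrow> f \<in> lmod_End R M \<and> f ` carrier M \<subseteq> N \<and>
    (\<exists>s\<in>lmod_End R M. \<exists>p\<in>P. f (s p) \<noteq> \<zero>\<^bsub>M\<^esub>) \<and>
    (\<forall>s\<in>lmod_End R M. \<forall>t\<in>lmod_End R M. \<forall>p\<in>P. f (s (f (t p))) = \<zero>\<^bsub>M\<^esub>)" for P f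
  \<comment> \<open>The choice is meaningful only where a good map exists; this is shown first under
    conditions on \<open>P k\<close>, which \<open>inv\<close> then establishes for all
    \<open>k\<close>.\<close>
  define pick where "pick P = (SOME f. good P f)" for P
  \<comment> \<open>\<open>P k\<close> is the product of the images of \<open>f 0\<close>, ...,
    \<open>f (k - 1)\<close>, begun with the whole module; each map is picked from the product
    before it.\<close>
  define P where "P = rec_nat (carrier M) (\<lambda>_ B. mprod R M B (pick B ` carrier M))"
  define f where "f k = pick (P k)" for k
  have P0: "P 0 = carrier M" and PS: "P (Suc k) = mprod R M (P k) (f k ` carrier M)" for k
    by (simp_all add: P_def f_def)
  have good: "good (P k) (f k)" if "P k \<subseteq> carrier M" "\<exists>p\<in>P k. p \<in> N \<and> p \<noteq> \<zero>\<^bsub>M\<^esub>" for k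
  proof -
    have "\<exists>g. good (P k) g"
      using that ex_square_zero_hom[OF proj assms(7) ann assms(9) that(1)] unfolding good_def by blast
    then show ?thesis unfolding f_def pick_def by (rule someI_ex)
  qed
  \<comment> \<open>Nonvanishing is tracked by an element of \<open>N\<close>, since the annihilator
    condition concerns elements of \<open>N\<close>. The next one is \<open>f k (s p)\<close>,
    because \<open>f k\<close> maps into \<open>N\<close>.\<close>
  have inv: "P k \<subseteq> carrier M \<and> (\<exists>p\<in>P k. p \<in> N \<and> p \<noteq> \<zero>\<^bsub>M\<^esub>)" for k
  proof (induction k)
    case 0
    then show ?case using assms(5) Nf(1,2) by (auto simp: P0)
  next
    case (Suc k)
    then have PM: "P k \<subseteq> carrier M" and G: "good (P k) (f k)" using good[of k] by auto
    then obtain s p where fk: "f k \<in> lmod_End R M" "f k ` carrier M \<subseteq> N"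
      and sp: "s \<in> lmod_End R M" "p \<in> P k" "f k (s p) \<noteq> \<zero>\<^bsub>M\<^esub>" by (auto simp: good_def)
    have B: "f k ` carrier M \<subseteq> carrier M" using lmod_homD(1)[OF fk(1)] by auto
    have "f k \<circ> s \<in> hom_into R M (f k ` carrier M)"
      unfolding hom_into_iff[OF B] using End_comp[OF fk(1) sp(1)] lmod_homD(1)[OF sp(1)] by auto
    then have "f k (s p) \<in> P (Suc k)"
      using hom_image_in_mprod[OF _ B PM sp(2), of "f k \<circ> s"] by (simp add: PS)
    moreover have "f k (s p) \<in> N" using fk sp PM lmod_homD(1)[OF sp(1)] by blast
    moreover have "P (Suc k) \<subseteq> carrier M"
      unfolding PS
      using PM by (intro mprod_image_subset[OF proj fk(1)])
        (auto intro!: lmod_homD(1)[OF fk(1)] dest: lmod_homD(1))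
    ultimately show ?case using sp(3) by blast
  qed
  have good: "good (P k) (f k)" for k using good inv by blast
  then have fE: "f k \<in> lmod_End R M" for k by (simp add: good_def)
  \<comment> \<open>The arbitrary \<open>s\<close> makes the induction work: elements of
    \<open>P (Suc k)\<close> are sums of values \<open>f k (t x)\<close> with \<open>x\<close> in
    \<open>P k\<close>. For \<open>n = k\<close> the universal clause of \<open>good\<close>
    applies; for \<open>n < k\<close> the map \<open>s \<circ> (f k \<circ> t)\<close> takes the
    place of \<open>s\<close>. The set \<open>?K\<close> is the kernel of
    \<open>f n \<circ> s\<close>.\<close>
  have zero: "f n (s p) = \<zero>\<^bsub>M\<^esub>" if "n < k" "s \<in> lmod_End R M" "p \<in> P k" for n k s p
    using that
  proof (induction k arbitrary: s p)
    case (Suc k)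
    let ?K = "{x \<in> carrier M. f n (s x) = \<zero>\<^bsub>M\<^esub>}"
    note fs = End_comp[OF fE[of n] \<open>s \<in> lmod_End R M\<close>]
    have "P (Suc k) \<subseteq> ?K"
      unfolding PS
    proof (rule mprod_image_subset[OF proj fE])
      show "P k \<subseteq> carrier M" using inv by blast
      show "\<zero>\<^bsub>M\<^esub> \<in> ?K" using End_zero[OF fs] by simp
      show "x \<oplus>\<^bsub>M\<^esub> y \<in> ?K" if "x \<in> ?K" "y \<in> ?K" for x y
        using that lmod_homD(2)[OF fs, of x y] by simp
      fix t x assume t: "t \<in> lmod_End R M" and x: "x \<in> P k"
      have "f k (t x) \<in> carrier M" using x inv[of k] by (auto intro!: lmod_homD(1)[OF fE] lmod_homD(1)[OF t])
      moreover have "f n (s (f k (t x))) = \<zero>\<^bsub>M\<^esub>"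
      proof (cases "n = k")
        case True
        then show ?thesis using good[of k] t x Suc.prems(2) by (simp add: good_def)
      next
        case False
        then show ?thesis
          using Suc.IH[OF _ End_comp[OF Suc.prems(2) End_comp[OF fE t]] x, of k] Suc.prems(1) by simp
      qed
      ultimately show "f k (t x) \<in> ?K" by simp
    qed simp
    then show ?case using Suc.prems(3) by blast
  qed simp
  \<comment> \<open>The maps are numbered from 0, the factors from 1; by truncated subtraction
    \<open>A 0\<close> equals \<open>A 1\<close>.\<close>
  define A where "A i = f (i - 1) ` carrier M" for i
  have seq: "mprod_seq R M A (Suc k) = P (Suc k)" for k
  proof (induction k)
    case 0
    then show ?case using mprod_carrier_image[OF fE, of 0] by (simp add: A_def PS P0)
  qed (simp add: A_def PS)
  show ?thesis
  proof (intro exI[of _ A] conjI allI impI)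
    fix i :: nat
    show "submodule (A i) R M" unfolding A_def by (rule submodule_image[OF fE])
    show "A i \<subseteq> N" using good by (simp add: A_def good_def)
  next
    fix k :: nat assume "0 < k"
    then show "mprod_seq R M A k \<noteq> {\<zero>\<^bsub>M\<^esub>}"
      using inv[of k] seq[of "k - 1"] by auto
  next
    fix k n :: nat assume n: "0 < n \<and> n \<le> k"
    then have *: "mprod_seq R M A k = P k" using seq[of "k - 1"] by simp
    \<comment> \<open>The product is generated by the values \<open>f (n - 1) (s p)\<close> with
      \<open>p\<close> in \<open>P k\<close>, and \<open>n - 1 < k\<close>, so \<open>zero\<close>
      annihilates each of them.\<close>
    have "mprod R M (P k) (A n) \<subseteq> {\<zero>\<^bsub>M\<^esub>}"
      unfolding A_def using inv[of k] zero[of "n - 1" k] n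
      by (intro mprod_image_subset[OF proj fE]) auto
    then show "mprod R M (mprod_seq R M A k) (A n) = {\<zero>\<^bsub>M\<^esub>}"
      using zero_in_mprod * by auto
  qed
qed

end
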